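(* There exists a bounded sequence $\{P_m\}_{m=1}^\infty$ of quadratic polynomials such that every iterated Julia set $\mathcal J_m$, $m \ge 0$, has positive two-dimensional Lebesgue measure, and there is a sequence $\{\mu_m\}_{m=0}^\infty$ of measurable line fields which is invariant under $\{P_m\}_{m=1}^\infty$ and such that for each $m \ge 0$ the support of $\mu_m$ is a set $\tilde{\mathcal J}_m \subset \mathcal J_m$ with $\mathcal J_m \setminus \tilde{\mathcal J}_m$ at most countable.
   Context: A bounded sequence of polynomials (with bounds $d \ge 2$, $K \ge 1$, $M \ge 0$) is a sequence $\{P_m\}_{m=1}^\infty$ with $P_m(z) = a_{d_m,m}z^{d_m} + \dots + a_{0,m}$, $2 \le d_m \le d$, $1/K \le |a_{d_m,m}| < K$, $|a_{k,m}| \le M$ for $0 \le k \le d_m-1$. Let $Q_{m,n} = P_n \circ \cdots \circ P_{m+1}$ for $0 \le m \le n$ ($Q_{m,m}$ the identity). The $m$th iterated Fatou set $\mathcal F_m$ is the set of $z \in \overline{\mathbb C}$ having a spherical neighbourhood on which $\{Q_{m,n}\}_{n \ge m}$ is normal, and $\mathcal J_m = \overline{\mathbb C} \setminus \mathcal F_m$. A measurable line field supported on a measurable set $E$ is a measurable Beltrami form $\mu = \mu(z)\,\frac{d\bar z}{dz}$ with $|\mu(z)| = 1$ for $z \in E$ and $\mu(z) = 0$ for $z \notin E$; $E$ is its support. The pullback of $\mu$ by a holomorphic map $f$ is $(f^*\mu)(z) = \mu(f(z))\,\overline{f'(z)}/f'(z)$. A sequence of line fields $\{\mu_m\}_{m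 \ge 0}$ is invariant under $\{P_m\}$ if $Q_{m,n}^*\mu_n = \mu_m$ (almost everywhere) for all $0 \le m < n$. *)

theory Defs
  imports "HOL-Analysis.Analysis" "HOL-Computational_Algebra.Polynomial"
begin

text \<open>Riemann sphere modelled as complex option; None is the point at infinity.\<close>

fun chordal :: "complex option \<Rightarrow> complex option \<Rightarrow> real" where
  "chordal (Some z) (Some w) = 2 * cmod (z - w) / sqrt ((1 + (cmod z)\<^sup>2) * (1 + (cmod w)\<^sup>2))"
| "chordal (Some z) None = 2 / sqrt (1 + (cmod z)\<^sup>2)"
| "chordal None (Some w) = 2 / sqrt (1 + (cmod w)\<^sup>2)"
| "chordal None None = 0"

definition ext_sphere :: "(complex \<Rightarrow> complex) \<Rightarrow> complex option \<Rightarrow> complex option" where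
  "ext_sphere f x = (case x of None \<Rightarrow> None | Some z \<Rightarrow> Some (f z))"

definition bounded_seq_poly :: "(nat \<Rightarrow> complex poly) \<Rightarrow> nat \<Rightarrow> real \<Rightarrow> real \<Rightarrow> bool" where
  "bounded_seq_poly P d K M \<longleftrightarrow> d \<ge> 2 \<and> K \<ge> 1 \<and> M \<ge> 0 \<and>
     (\<forall>m\<ge>1. 2 \<le> degree (P m) \<and> degree (P m) \<le> d \<and>
        1 / K \<le> cmod (lead_coeff (P m)) \<and> cmod (lead_coeff (P m)) < K \<and>
        (\<forall>k<degree (P m). cmod (coeff (P m) k) \<le> M))"

fun Qcomp :: "(nat \<Rightarrow> complex poly) \<Rightarrow> nat \<Rightarrow> nat \<Rightarrow> complex \<Rightarrow> complex" where
  "Qcomp P m 0 = id"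
| "Qcomp P m (Suc n) = (if Suc n \<le> m then id else poly (P (Suc n)) \<circ> Qcomp P m n)"

definition normal_on :: "nat set \<Rightarrow> (nat \<Rightarrow> complex option \<Rightarrow> complex option) \<Rightarrow> complex option set \<Rightarrow> bool" where
  "normal_on I F U \<longleftrightarrow>
     (\<forall>s::nat\<Rightarrow>nat. (\<forall>k. s k \<in> I) \<longrightarrow>
        (\<exists>(r::nat\<Rightarrow>nat) (g::complex option \<Rightarrow> complex option). strict_mono r \<and>
           (\<forall>x\<in>U. \<exists>\<delta>>0. \<forall>\<epsilon>>0. \<exists>N::nat. \<forall>k\<ge>N. \<forall>y\<in>U. chordal y x < \<delta> \<longrightarrow>
               chordal (F (s (r k)) y) (g y) < \<epsilon>)))"

definition fatou :: "(nat \<Rightarrow> complex poly) \<Rightarrow> nat \<Rightarrow> complex option set" where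
  "fatou P m = {z. \<exists>\<rho>>0. normal_on {m..} (\<lambda>n. ext_sphere (Qcomp P m n)) {w. chordal w z < \<rho>}}"

definition julia :: "(nat \<Rightarrow> complex poly) \<Rightarrow> nat \<Rightarrow> complex option set" where
  "julia P m = UNIV - fatou P m"

definition julia_C :: "(nat \<Rightarrow> complex poly) \<Rightarrow> nat \<Rightarrow> complex set" where
  "julia_C P m = {z. Some z \<in> julia P m}"

definition line_field_on :: "complex set \<Rightarrow> (complex \<Rightarrow> complex) \<Rightarrow> bool" where
  "line_field_on E \<mu> \<longleftrightarrow> E \<in> sets lebesgue \<and> \<mu> \<in> borel_measurable lebesgue \<and>
     (\<forall>z\<in>E. cmod (\<mu> z) = 1) \<and> (\<forall>z. z \<notin> E \<longrightarrow> \<mu> z = 0)"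

definition pullback :: "(complex \<Rightarrow> complex) \<Rightarrow> (complex \<Rightarrow> complex) \<Rightarrow> complex \<Rightarrow> complex" where
  "pullback f \<mu> z = \<mu> (f z) * cnj (deriv f z) / deriv f z"

end

(*
  All polynomials are P_m = b z + a z^2 with |a| = 1 and b in {0, 1}, arranged in blocks: N times z^2,
  then n times z + a z^2, then n times z - a z^2. The point |z| > 3 escapes under every such sequence,
  so J_m is the set K_m of nonescaping points as soon as the escaping points are dense.

  The squarings push the points of the unit disc close to 0. In the coordinate X = -1/(a z) the maps
  z + a z^2 and z - a z^2 are close to X + 1 and X - 1 near infinity, so the rest of a block translates
  by n and back: it is nearly the identity except near a slit, where X passes close to 0 and the orbit
  escapes. Choosing the slit through a prescribed open set makes the escaping points dense, while the
  proportion of the area lost in the blocks is summable; hence K_0 has positive area.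

  The radial line field z / cnj z is invariant under z^2 and is nearly preserved by the second half of
  a block, off sets of summable area. By Borel-Cantelli its pullbacks from the block ends converge
  almost everywhere on K_m, and the limits form the invariant sequence.
*)
theory Submission
  imports Defs "HOL-Complex_Analysis.Conformal_Mappings" "HOL-Real_Asymp.Real_Asymp"
begin

section \<open>Normality and nonescaping points\<close>

text \<open>The obstacle is to reach a prescribed open set at little cost in area. Let v < 1 be the
  modulus, at the start of a block, of a point that is to escape. The squarings turn v into x = v^M
  with M = 2^N, and along the slit a gain of at least x^2 per step is guaranteed, so n is taken near
  4 / x^2. This is enormous, but the error of the rest is not proportional to n: a step at distance
  D from 0 in the coordinate X deviates from a translation by about 1 / D, and since the distances
  grow linearly these deviations sum to a harmonic number, of order ln n, hence of order M. Points
  of modulus below r < 1 at the start of the block have |X| at least (1/r)^M, exponential in M. So a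
  large N makes the relative error as small as desired, whatever v, r and the width of the sector
  about the slit.

  All areas are measured in the plane of time 0, through preimages under the composition built so
  far. The losses of different blocks then simply add up, and no area distortion has to be
  estimated.\<close>

definition quads :: "complex poly set" where
  "quads = {[:0, b, a:] | a b. cmod a = 1 \<and> b \<in> {0, 1}}"

text \<open>The two branches of \<open>csqrt\<close> are differentiable only off the cut, so they
  cover the preimage except for the points whose square lies on the cut. Those lie on the imaginary
  axis, a null line.\<close>

lemma negligible_vimage_square:
  fixes E :: "complex set"
  assumes "negligible E"
  shows "negligible {z. z\<^sup>2 \<in> E}"
proof -
  let ?E = "E - \<real>\<^sub>\<le>\<^sub>0"
  have E: "negligible ?E" using assms by (rule negligible_subset) auto
  have d: "csqrt differentiable_on ?E" "(\<lambda>z. - csqrt z) differentiable_on ?E"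
    by (auto intro!: differentiable_on_minus holomorphic_on_imp_differentiable_on holomorphic_intros)
  have "negligible {z. Re z = 0}"
    using negligible_standard_hyperplane[of "1::complex" 0] by simp
  then have "negligible (csqrt ` ?E \<union> (\<lambda>z. - csqrt z) ` ?E \<union> {z. Re z = 0})"
    using negligible_differentiable_image_negligible[OF _ E d(1)] negligible_differentiable_image_negligible[OF _ E d(2)] by simp
  moreover have "{z. z\<^sup>2 \<in> E} \<subseteq> csqrt ` ?E \<union> (\<lambda>z. - csqrt z) ` ?E \<union> {z. Re z = 0}"
  proof
    fix z assume z: "z \<in> {z. z\<^sup>2 \<in> E}"
    show "z \<in> csqrt ` ?E \<union> (\<lambda>z. - csqrt z) ` ?E \<union> {z. Re z = 0}"
    proof (cases "z\<^sup>2 \<in> \<real>\<^sub>\<le>\<^sub>0")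
      case True
      then have "Re z * Im z = 0" "(Re z)\<^sup>2 \<le> (Im z)\<^sup>2"
        by (auto simp: complex_nonpos_Reals_iff power2_eq_square)
      then show ?thesis by auto
    next
      case False
      have "(csqrt (z\<^sup>2))\<^sup>2 = z\<^sup>2" by simp
      then have "z = csqrt (z\<^sup>2) \<or> z = - csqrt (z\<^sup>2)" by (metis power2_eq_iff minus_minus)
      then show ?thesis using z False by blast
    qed
  qed
  ultimately show ?thesis by (rule negligible_subset)
qed

text \<open>Completing the square with h = b / (2 a) reduces the preimage to affine maps and a
  preimage under squaring.\<close>

lemma negligible_vimage_quad:
  assumes "p \<in> quads" "negligible E"
  shows "negligible {z. poly p z \<in> E}"
proof -
  obtain a b where p: "p = [:0, b, a:]" and a: "a \<noteq> 0"
    using assms(1) unfolding quads_def by force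
  define h where "h = b / (2 * a)"
  let ?E = "(\<lambda>e. e / a + h\<^sup>2) ` E"
  have "negligible ?E"
    using a by (intro negligible_differentiable_image_negligible assms(2))
      (auto intro!: holomorphic_on_imp_differentiable_on holomorphic_intros)
  then have "negligible ((\<lambda>y. y - h) ` {y. y\<^sup>2 \<in> ?E})"
    by (intro negligible_differentiable_image_negligible[OF order_refl negligible_vimage_square])
      (auto intro!: holomorphic_on_imp_differentiable_on holomorphic_intros)
  moreover have "{z. poly p z \<in> E} \<subseteq> (\<lambda>y. y - h) ` {y. y\<^sup>2 \<in> ?E}"
  proof
    fix z assume "z \<in> {z. poly p z \<in> E}"
    moreover have "poly p z / a + h\<^sup>2 = (z + h)\<^sup>2"
      using a by (simp add: p h_def power2_eq_square field_simps)
    ultimately have "(z + h)\<^sup>2 \<in> ?E" by (metis imageI mem_Collect_eq)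
    then show "z \<in> (\<lambda>y. y - h) ` {y. y\<^sup>2 \<in> ?E}" by (intro image_eqI[of _ _ "z + h"]) auto
  qed
  ultimately show ?thesis by (rule negligible_subset)
qed

lemma negligible_vimage_fold:
  assumes "set l \<subseteq> quads" "negligible E"
  shows "negligible {z. fold poly l z \<in> E}"
  using assms
proof (induction l arbitrary: E rule: rev_induct)
  case (snoc p l)
  then have "negligible {z. fold poly l z \<in> {z. poly p z \<in> E}}"
    by (intro snoc.IH negligible_vimage_quad) auto
  then show ?case by simp
qed simp

lemma holomorphic_fold_poly [holomorphic_intros]: "(\<lambda>z. fold poly l z) holomorphic_on S"
proof (induction l rule: rev_induct)
  case (snoc p l)
  have "poly p \<circ> fold poly l holomorphic_on S"
    by (rule holomorphic_on_compose[OF snoc])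
      (auto simp: holomorphic_on_def field_differentiable_def intro: has_field_derivative_at_within poly_DERIV)
  then show ?case by (simp add: o_def)
qed (simp add: holomorphic_intros)

text \<open>Open mapping theorem: a composition constant on a nonempty open set would place that set
  in the null preimage of a point.\<close>

lemma open_fold_image:
  assumes "set l \<subseteq> quads" "open B"
  shows "open (fold poly l ` B)"
proof (rule open_mapping_thm2[where S = B])
  fix X assume X: "open X" "X \<subseteq> B" "X \<noteq> {}"
  show "\<not> fold poly l constant_on X"
  proof
    assume "fold poly l constant_on X"
    then obtain c where "\<And>x. x \<in> X \<Longrightarrow> fold poly l x = c" unfolding constant_on_def by blast
    then have "X \<subseteq> {z. fold poly l z \<in> {c}}" by auto
    then have "negligible X" using negligible_subset negligible_vimage_fold[OF assms(1) negligible_sing] by blast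
    then show False using X open_not_negligible by blast
  qed
qed (use assms holomorphic_fold_poly in auto)

text \<open>Beyond radius 3 the factor |z| - 1 is at least 2. One radius thus serves all maps of the
  family, which makes escape irreversible and lets a fixed threshold define the nonescaping
  set.\<close>

lemma quad_escape:
  assumes "p \<in> quads" "3 < cmod z"
  shows "2 * cmod z \<le> cmod (poly p z)"
proof -
  obtain a b where p: "p = [:0, b, a:]" and a: "cmod a = 1" and b: "cmod b \<le> 1"
    using assms(1) unfolding quads_def by force
  have "cmod z * 2 \<le> cmod z * (cmod (z * a) - cmod b)"
    using a b assms(2) by (intro mult_left_mono) (auto simp: norm_mult)
  also have "\<dots> \<le> cmod z * cmod (b + z * a)"
    using norm_diff_ineq[of "z * a" b] by (intro mult_left_mono) (auto simp: add.commute)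
  also have "\<dots> = cmod (poly p z)" by (simp add: p norm_mult)
  finally show ?thesis by simp
qed

lemma fold_escape:
  assumes "set l \<subseteq> quads" "3 < cmod z"
  shows "3 < cmod (fold poly l z)"
  using assms
proof (induction l arbitrary: z)
  case (Cons p l)
  then have "3 < cmod (poly p z)" using quad_escape[of p z] by auto
  then show ?case using Cons by simp
qed simp

section \<open>The chordal metric\<close>

text \<open>Inverse stereographic projection onto the unit sphere in the product of the plane and
  the line. It turns \<open>chordal\<close> into a Euclidean distance, from which the triangle
  inequality is inherited.\<close>

fun sph :: "complex option \<Rightarrow> complex \<times> real" where
  "sph None = (0, 1)"
| "sph (Some z) = (of_real (2 / (1 + (cmod z)\<^sup>2)) * z, ((cmod z)\<^sup>2 - 1) / (1 + (cmod z)\<^sup>2))"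

lemma chordal_eq_dist: "chordal x y = dist (sph x) (sph y)"
proof -
  have pos: "1 + (cmod z)\<^sup>2 > 0" for z by (simp add: add_pos_nonneg)
  have dist2: "(dist (u, s) (v, t))\<^sup>2 = (cmod (u - v))\<^sup>2 + (s - t)\<^sup>2" for u v :: complex and s t :: real
    by (simp add: dist_prod_def dist_norm)
  have sph_Some: "sph (Some z) = (of_real (2 / (1 + (cmod z)\<^sup>2)) * z, (1 + (cmod z)\<^sup>2 - 2) / (1 + (cmod z)\<^sup>2))" for z
    by simp
  have SN: "dist (sph (Some z)) (sph None) = 2 / sqrt (1 + (cmod z)\<^sup>2)" for z
  proof -
    define A where "A = 1 + (cmod z)\<^sup>2"
    have A: "A > 0" "(cmod z)\<^sup>2 = A - 1" using pos by (auto simp: A_def)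
    have "(dist (sph (Some z)) (sph None))\<^sup>2 = (2 / A)\<^sup>2 * (A - 1) + ((A - 2) / A - 1)\<^sup>2"
      unfolding sph_Some sph.simps(1) dist2 A_def[symmetric] diff_zero norm_mult power_mult_distrib norm_of_real power2_abs A(2) by simp
    also have "\<dots> = (2 / sqrt A)\<^sup>2" using A(1) by (simp add: power_divide) (simp add: field_simps power2_eq_square)
    finally show ?thesis unfolding A_def by (rule power2_eq_imp_eq) auto
  qed
  have SS: "dist (sph (Some z)) (sph (Some w)) = 2 * cmod (z - w) / sqrt ((1 + (cmod z)\<^sup>2) * (1 + (cmod w)\<^sup>2))" for z w
  proof -
    define A B where "A = 1 + (cmod z)\<^sup>2" and "B = 1 + (cmod w)\<^sup>2"
    have A: "A > 0" "(cmod z)\<^sup>2 = A - 1" "B > 0" "(cmod w)\<^sup>2 = B - 1" using pos by (auto simp: A_def B_def)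
    have ip: "(cmod (of_real s * z - of_real t * w))\<^sup>2 = s\<^sup>2 * (A - 1) + t\<^sup>2 * (B - 1) - 2 * s * t * (z \<bullet> w)" for s t
      unfolding A(2,4)[symmetric] cmod_power2 inner_complex_def
      by (simp add: power2_eq_square algebra_simps)
    have "(dist (sph (Some z)) (sph (Some w)))\<^sup>2
        = (2 / A)\<^sup>2 * (A - 1) + (2 / B)\<^sup>2 * (B - 1) - 2 * (2 / A) * (2 / B) * (z \<bullet> w) + ((A - 2) / A - (B - 2) / B)\<^sup>2"
      unfolding sph_Some dist2 A_def[symmetric] B_def[symmetric] ip by (rule refl)
    also have "\<dots> = 4 * (A + B - 2 - 2 * (z \<bullet> w)) / (A * B)"
      using A(1,3) by (simp add: divide_simps) (simp add: algebra_simps power2_eq_square)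
    also have "A + B - 2 - 2 * (z \<bullet> w) = (cmod (z - w))\<^sup>2"
      using ip[of 1 1] by simp
    also have "4 * (cmod (z - w))\<^sup>2 / (A * B) = (2 * cmod (z - w) / sqrt (A * B))\<^sup>2"
      using A(1,3) by (simp add: power_divide power_mult_distrib)
    finally show ?thesis unfolding A_def B_def by (rule power2_eq_imp_eq) auto
  qed
  show ?thesis by (cases x; cases y) (simp_all only: chordal.simps SS SN dist_commute[of "sph None"] dist_self)
qed

lemma chordal_le: "chordal (Some y) (Some z) \<le> 2 * cmod (y - z)"
proof -
  have "1 \<le> sqrt ((1 + (cmod y)\<^sup>2) * (1 + (cmod z)\<^sup>2))"
    by (simp add: algebra_simps)
  then have "2 * cmod (y - z) / sqrt ((1 + (cmod y)\<^sup>2) * (1 + (cmod z)\<^sup>2)) \<le> 2 * cmod (y - z) / 1"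
    by (intro divide_left_mono) auto
  then show ?thesis by simp
qed

lemma sqrt_one_plus_power2_le: "0 \<le> x \<Longrightarrow> sqrt (1 + x\<^sup>2) \<le> 1 + (x::real)"
  by (rule real_le_lsqrt) (auto simp: power2_eq_square algebra_simps)

text \<open>With A = 1 + |z|, a finite point at Euclidean distance t from z has chordal distance at
  least 2 t / ((A + t) A). This increases with t, so its value at t = e is a suitable radius for
  finite points; the bound 2 / A excludes the point at infinity.\<close>

lemma chordal_nhd:
  assumes "0 < e"
  obtains \<rho> where "0 < \<rho>" "\<And>w. chordal w (Some z) < \<rho> \<Longrightarrow> \<exists>y. w = Some y \<and> cmod (y - z) < e"
proof -
  define A where "A = 1 + cmod z"
  have A: "A > 0" unfolding A_def by (simp add: add_pos_nonneg)
  define \<rho> where "\<rho> = min (2 * e / ((A + e) * A)) (2 / A)"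
  have \<rho>: "0 < \<rho>" unfolding \<rho>_def using A assms by auto
  have zA: "sqrt (1 + (cmod z)\<^sup>2) \<le> A" "0 < sqrt (1 + (cmod z)\<^sup>2)" unfolding A_def
    using sqrt_one_plus_power2_le by (auto simp: add_pos_nonneg)
  show thesis
  proof (rule that[OF \<rho>])
    fix w assume w: "chordal w (Some z) < \<rho>"
    show "\<exists>y. w = Some y \<and> cmod (y - z) < e"
    proof (cases w)
      case None
      have "2 / A \<le> 2 / sqrt (1 + (cmod z)\<^sup>2)" using zA A by (intro divide_left_mono) auto
      then show ?thesis using w None by (simp add: \<rho>_def)
    next
      case (Some y)
      define t where "t = cmod (y - z)"
      have "t < e"
      proof (rule ccontr)
        assume "\<not> t < e"
        then have t: "e \<le> t" by simp
        have "cmod y \<le> cmod z + t" unfolding t_def by (metis norm_triangle_sub add.commute)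
        then have "sqrt (1 + (cmod y)\<^sup>2) \<le> A + t"
          using sqrt_one_plus_power2_le[of "cmod y"] by (simp add: A_def)
        then have "sqrt ((1 + (cmod y)\<^sup>2) * (1 + (cmod z)\<^sup>2)) \<le> (A + t) * A"
          unfolding real_sqrt_mult using zA A t assms by (intro mult_mono) auto
        moreover have "0 < sqrt ((1 + (cmod y)\<^sup>2) * (1 + (cmod z)\<^sup>2))" by (simp add: add_pos_nonneg)
        ultimately have "2 * t / ((A + t) * A) \<le> 2 * t / sqrt ((1 + (cmod y)\<^sup>2) * (1 + (cmod z)\<^sup>2))"
          using t assms A by (intro divide_left_mono mult_pos_pos) auto
        also have "\<dots> = chordal w (Some z)" by (simp add: Some t_def)
        also have "\<dots> < 2 * e / ((A + e) * A)" using w by (simp add: \<rho>_def)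
        finally have "2 * t / ((A + t) * A) < 2 * e / ((A + e) * A)" .
        moreover have "2 * e / ((A + e) * A) \<le> 2 * t / ((A + t) * A)"
          using t A assms by (simp add: divide_simps) (simp add: algebra_simps)
        ultimately show False by linarith
      qed
      then show ?thesis using Some by (simp add: t_def)
    qed
  qed
qed

section \<open>Compositions and nonescaping points\<close>

lemma Qcomp_self [simp]: "n \<le> m \<Longrightarrow> Qcomp P m n = id"
  by (cases n) auto

lemma Qcomp_eq_fold:
  assumes "m \<le> n"
  shows "Qcomp P m n = fold poly (map P [Suc m..<Suc n])"
  using assms
proof (induction n rule: dec_induct)
  case (step n)
  then have "[Suc m..<Suc (Suc n)] = [Suc m..<Suc n] @ [Suc n]" by simp
  then show ?case using step by (simp del: upt_Suc)
qed simp

lemma Qcomp_Qcomp: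
  assumes "m \<le> k" "k \<le> n"
  shows "Qcomp P m n z = Qcomp P k n (Qcomp P m k z)"
proof -
  have "[Suc m..<Suc n] = [Suc m..<Suc k] @ [Suc k..<Suc n]"
    using assms by (metis Suc_le_mono le_add_diff_inverse upt_add_eq_append)
  then show ?thesis using assms by (simp add: Qcomp_eq_fold del: upt_Suc)
qed

lemma holomorphic_Qcomp [holomorphic_intros]: "Qcomp P m n holomorphic_on S"
proof (cases "m \<le> n")
  case True
  show ?thesis unfolding Qcomp_eq_fold[OF True] by (rule holomorphic_fold_poly)
next
  case False then show ?thesis by (simp add: id_def)
qed

lemma continuous_on_Qcomp: "continuous_on S (Qcomp P m n)"
  by (intro holomorphic_on_imp_continuous_on holomorphic_intros)

lemma isCont_Qcomp: "isCont (Qcomp P m n) z"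
  using continuous_on_Qcomp[of UNIV] by (simp add: continuous_on_eq_continuous_at)

definition nonescaping :: "(nat \<Rightarrow> complex poly) \<Rightarrow> nat \<Rightarrow> complex set" where
  "nonescaping P m = {z. \<forall>n\<ge>m. cmod (Qcomp P m n z) \<le> 3}"

lemma closed_nonescaping: "closed (nonescaping P m)"
proof -
  have "nonescaping P m = (\<Inter>n\<in>{m..}. Qcomp P m n -` cball 0 3)"
    by (auto simp: nonescaping_def)
  then show ?thesis
    by (auto intro!: closed_INT continuous_closed_vimage isCont_Qcomp)
qed

context
  fixes P :: "nat \<Rightarrow> complex poly"
  assumes P: "\<And>n. P (Suc n) \<in> quads"
begin

lemma set_map_P: "set (map P [Suc m..<k]) \<subseteq> quads"
proof -
  have "P i \<in> quads" if "Suc m \<le> i" for i using P[of "i - 1"] that by simp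
  then show ?thesis by auto
qed

lemma Qcomp_escape:
  assumes "m \<le> k" "k \<le> n" "3 < cmod (Qcomp P m k z)"
  shows "3 < cmod (Qcomp P m n z)"
  using assms fold_escape[OF set_map_P] by (simp add: Qcomp_Qcomp[of m k n] Qcomp_eq_fold[of k n] del: upt_Suc)

lemma Qcomp_in_nonescaping_iff:
  assumes "m \<le> k"
  shows "Qcomp P m k z \<in> nonescaping P k \<longleftrightarrow> z \<in> nonescaping P m"
proof
  assume *: "Qcomp P m k z \<in> nonescaping P k"
  show "z \<in> nonescaping P m" unfolding nonescaping_def
  proof safe
    fix n assume "m \<le> n"
    show "cmod (Qcomp P m n z) \<le> 3"
    proof (cases "k \<le> n")
      case True then show ?thesis using * assms by (simp add: Qcomp_Qcomp[of m k n] nonescaping_def)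
    next
      case False
      have "cmod (Qcomp P m k z) \<le> 3" using * by (auto simp: nonescaping_def dest: spec[of _ k])
      then show ?thesis using Qcomp_escape[of m n k z] \<open>m \<le> n\<close> False by linarith
    qed
  qed
next
  assume *: "z \<in> nonescaping P m"
  have "cmod (Qcomp P k n (Qcomp P m k z)) \<le> 3" if "k \<le> n" for n
    unfolding Qcomp_Qcomp[OF assms that, symmetric] using * assms that by (simp add: nonescaping_def)
  then show "Qcomp P m k z \<in> nonescaping P k" by (simp add: nonescaping_def)
qed

text \<open>Doubling above modulus 3 adds more than 1 per step. The bound does not depend on z, so
  it yields the uniform convergence to infinity that normality asks for.\<close>

lemma Qcomp_growth:
  assumes "m \<le> k" "k \<le> n" "3 < cmod (Qcomp P m k z)"
  shows "real n - real k < cmod (Qcomp P m n z)"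
  using assms(2)
proof (induction n rule: dec_induct)
  case (step n)
  have "3 < cmod (Qcomp P m n z)" using Qcomp_escape assms step by blast
  then have "cmod (Qcomp P m n z) + 3 < cmod (poly (P (Suc n)) (Qcomp P m n z))"
    using quad_escape[OF P[of n], of "Qcomp P m n z"] by linarith
  then show ?case using step assms by simp
qed (use assms in auto)

lemma normal_on_escaping:
  assumes "m \<le> k" and U: "\<And>z. Some z \<in> U \<Longrightarrow> 3 < cmod (Qcomp P m k z)"
  shows "normal_on {m..} (\<lambda>n. ext_sphere (Qcomp P m n)) U"
  unfolding normal_on_def
proof (intro allI impI)
  fix s :: "nat \<Rightarrow> nat" assume "\<forall>j. s j \<in> {m..}"
  show "\<exists>r g. strict_mono r \<and> (\<forall>x\<in>U. \<exists>\<delta>>0. \<forall>\<epsilon>>0. \<exists>N::nat. \<forall>j\<ge>N. \<forall>y\<in>U. chordal y x < \<delta> \<longrightarrow>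
               chordal (ext_sphere (Qcomp P m (s (r j))) y) (g y) < \<epsilon>)"
  \<comment> \<open>The index sequences in \<open>normal_on\<close> need not increase. Either one
    value recurs infinitely often and gives a constant subsequence, or every value occurs finitely
    often, and then the whole sequence tends to infinity uniformly on \<open>U\<close>.\<close>
  proof (cases "\<exists>v. infinite {j. s j = v}")
    case True
    then obtain v where "infinite {j. s j = v}" by blast
    then obtain r :: "nat \<Rightarrow> nat" where r: "strict_mono r" "\<And>j. r j \<in> {j. s j = v}" by (metis infinite_enumerate)
    show ?thesis
    proof (intro exI[of _ r] exI[of _ "ext_sphere (Qcomp P m v)"] conjI ballI)
      show "strict_mono r" by fact
      show "\<exists>\<delta>>0. \<forall>\<epsilon>>0. \<exists>N::nat. \<forall>j\<ge>N. \<forall>y\<in>U. chordal y x < \<delta> \<longrightarrow>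
               chordal (ext_sphere (Qcomp P m (s (r j))) y) (ext_sphere (Qcomp P m v) y) < \<epsilon>" for x
        using r by (intro exI[of _ 1]) (auto simp: chordal_eq_dist)
    qed
  next
    case False
    show ?thesis
    proof (intro exI[of _ "id :: nat \<Rightarrow> nat"] exI[of _ "\<lambda>_. None"] conjI ballI)
      show "strict_mono (id :: nat \<Rightarrow> nat)" by (simp add: strict_mono_def)
      fix x
      have "\<exists>N. \<forall>j\<ge>N. \<forall>y\<in>U. chordal (ext_sphere (Qcomp P m (s (id j))) y) None < \<epsilon>" if \<epsilon>: "0 < \<epsilon>" for \<epsilon>
      proof -
        obtain n0 :: nat where n0: "2 / \<epsilon> < n0" using reals_Archimedean2 by blast
        have "{j. s j < k + n0} = (\<Union>v<k + n0. {j. s j = v})" by auto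
        then have "finite {j. s j < k + n0}" using False by auto
        then obtain N where N: "\<And>j. s j < k + n0 \<Longrightarrow> j < N"
          by (metis finite_nat_set_iff_bounded mem_Collect_eq)
        show ?thesis
        proof (intro exI allI ballI impI)
          fix j y assume j: "N \<le> j" and y: "y \<in> U"
          show "chordal (ext_sphere (Qcomp P m (s (id j))) y) None < \<epsilon>"
          proof (cases y)
            case None then show ?thesis using \<epsilon> by (simp add: ext_sphere_def)
          next
            case (Some z)
            define q where "q = Qcomp P m (s j) z"
            have "k + n0 \<le> s j" using N[of j] j by linarith
            then have "2 / \<epsilon> < cmod q" 
              using Qcomp_growth[OF assms(1) _ U[of z], of "s j"] Some y n0 by (simp add: q_def)
            moreover from this have "0 < cmod q" using \<epsilon> by (auto intro: less_trans[of 0 "2 / \<epsilon>"])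
            ultimately have "2 / cmod q < \<epsilon>" using \<epsilon> by (simp add: field_simps)
            moreover have "2 / sqrt (1 + (cmod q)\<^sup>2) \<le> 2 / cmod q"
              using \<open>0 < cmod q\<close> by (intro divide_left_mono real_le_rsqrt mult_pos_pos) (auto simp: add_pos_nonneg)
            ultimately show ?thesis by (simp add: Some ext_sphere_def q_def)
          qed
        qed
      qed
      then show "\<exists>\<delta>>0. \<forall>\<epsilon>>0. \<exists>N. \<forall>j\<ge>N. \<forall>y\<in>U. chordal y x < \<delta> \<longrightarrow>
               chordal (ext_sphere (Qcomp P m (s (id j))) y) None < \<epsilon>"
        by (intro exI[of _ 1]) force
    qed
  qed
qed

lemma julia_subset: "julia P m \<subseteq> Some ` nonescaping P m"
proof
  fix x assume x: "x \<in> julia P m"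
  have *: "x \<in> fatou P m" if "0 < \<rho>" "m \<le> k" "\<And>z. chordal (Some z) x < \<rho> \<Longrightarrow> 3 < cmod (Qcomp P m k z)" for \<rho> k
    unfolding fatou_def using that normal_on_escaping[of m k "{w. chordal w x < \<rho>}"] by blast
  show "x \<in> Some ` nonescaping P m"
  proof (cases x)
    case None
    have "3 < cmod z" if "chordal (Some z) None < 1 / 2" for z
    proof (rule ccontr)
      assume "\<not> 3 < cmod z"
      then have "sqrt (1 + (cmod z)\<^sup>2) \<le> 4" using sqrt_one_plus_power2_le[of "cmod z"] by simp
      moreover have "0 < sqrt (1 + (cmod z)\<^sup>2)" by (simp add: add_pos_nonneg)
      ultimately have "1 / 2 \<le> 2 / sqrt (1 + (cmod z)\<^sup>2)" by (simp add: field_simps)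
      then show False using that by simp
    qed
    then have "x \<in> fatou P m" using *[of "1/2" m] None by simp
    then show ?thesis using x by (simp add: julia_def)
  next
    case (Some z)
    have "z \<in> nonescaping P m"
    proof (rule ccontr)
      assume "z \<notin> nonescaping P m"
      then obtain k where k: "m \<le> k" "3 < cmod (Qcomp P m k z)" by (auto simp: nonescaping_def not_le)
      have "open {z. 3 < cmod (Qcomp P m k z)}"
        by (intro open_Collect_less continuous_intros continuous_on_Qcomp)
      then obtain e where e: "0 < e" "\<And>y. cmod (y - z) < e \<Longrightarrow> 3 < cmod (Qcomp P m k y)"
        using k(2) unfolding open_dist by (auto simp: dist_norm)
      obtain \<rho> where \<rho>: "0 < \<rho>" "\<And>w. chordal w (Some z) < \<rho> \<Longrightarrow> \<exists>y. w = Some y \<and> cmod (y - z) < e"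
        using chordal_nhd[OF e(1)] by blast
      then have "x \<in> fatou P m" using *[of \<rho> k] k e Some by blast
      then show False using x by (simp add: julia_def)
    qed
    then show ?thesis using Some by blast
  qed
qed

text \<open>Uniform convergence near z would keep the iterate at a fixed time N close to all later
  ones of the subsequence, at every point near z. A nearby escaping point z' is eventually near
  infinity, hence near infinity already at time N; but there continuity keeps it close to the
  iterate of z, of modulus at most 3.\<close>

lemma nonescaping_in_julia:
  assumes z: "z \<in> nonescaping P m"
    and dense: "\<And>V. open V \<Longrightarrow> z \<in> V \<Longrightarrow> \<exists>z'\<in>V. z' \<notin> nonescaping P m"
  shows "Some z \<in> julia P m"
proof (rule ccontr)
  assume "Some z \<notin> julia P m"
  then obtain \<rho> where \<rho>: "\<rho> > 0" and normal: "normal_on {m..} (\<lambda>n. ext_sphere (Qcomp P m n)) {w. chordal w (Some z) < \<rho>}"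
    by (auto simp: julia_def fatou_def)
  let ?U = "{w. chordal w (Some z) < \<rho>}"
  obtain r :: "nat \<Rightarrow> nat" and g where r: "strict_mono r" and
    "\<forall>x\<in>?U. \<exists>\<delta>>0. \<forall>\<epsilon>>0. \<exists>N::nat. \<forall>j\<ge>N. \<forall>y\<in>?U. chordal y x < \<delta> \<longrightarrow>
               chordal (ext_sphere (Qcomp P m (m + r j)) y) (g y) < \<epsilon>"
    using normal[unfolded normal_on_def, rule_format, of "\<lambda>k. m + k"] by auto
  moreover have zU: "Some z \<in> ?U" using \<rho> by (simp add: chordal_eq_dist)
  ultimately obtain \<delta> where \<delta>: "\<delta> > 0" and
    conv: "\<And>\<epsilon>. \<epsilon> > 0 \<Longrightarrow> \<exists>N::nat. \<forall>j\<ge>N. \<forall>y\<in>?U. chordal y (Some z) < \<delta> \<longrightarrow>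
               chordal (ext_sphere (Qcomp P m (m + r j)) y) (g y) < \<epsilon>"
    by blast
  obtain N where N: "\<And>j y. N \<le> j \<Longrightarrow> chordal y (Some z) < min \<rho> \<delta> \<Longrightarrow>
               chordal (ext_sphere (Qcomp P m (m + r j)) y) (g y) < 1 / 10"
    using conv[of "1/10"] by auto
  define Q where "Q = Qcomp P m (m + r N)"
  have cont: "isCont Q z" unfolding Q_def by (rule isCont_Qcomp)
  then obtain d where d: "d > 0" "\<And>y. cmod (y - z) < d \<Longrightarrow> cmod (Q y - Q z) < 1 / 20"
    unfolding continuous_at_eps_delta dist_norm by (metis zero_less_divide_iff zero_less_numeral zero_less_one)
  define V where "V = ball z (min d (min \<rho> \<delta> / 2))"
  have "open V" "z \<in> V" using d \<rho> \<delta> by (auto simp: V_def)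
  then obtain z' where z': "z' \<in> V" "z' \<notin> nonescaping P m" using dense by blast
  then obtain k where k: "m \<le> k" "3 < cmod (Qcomp P m k z')" by (auto simp: nonescaping_def not_le)
  have z'd: "cmod (z' - z) < d" "chordal (Some z') (Some z) < min \<rho> \<delta>"
    using z'(1) chordal_le[of z' z] by (auto simp: V_def dist_norm norm_minus_commute)
  have zz: "chordal (Some z) (Some z) < min \<rho> \<delta>" using \<rho> \<delta> by (simp add: chordal_eq_dist)
  \<comment> \<open>At least 20 steps after the escape at time \<open>k\<close> the modulus exceeds
    20, within 1/10 of infinity. A point of modulus at most 3 is at distance at least 1/2 from
    infinity, which the four errors of 1/10 in \<open>c1\<close> to \<open>c4\<close> cannot
    bridge.\<close>
  define j where "j = max N (k + 20)"
  define q where "q = Qcomp P m (m + r j) z'"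
  have "j \<le> r j" using r by (rule strict_mono_imp_increasing)
  then have "20 \<le> real (m + r j) - real k" "k \<le> m + r j" unfolding j_def by auto
  then have q20: "20 < cmod q" using Qcomp_growth[OF k(1) _ k(2), of "m + r j"] by (simp add: q_def)
  have "20 < sqrt (1 + (cmod q)\<^sup>2)"
    using q20 by (meson less_le_trans real_le_rsqrt le_add_same_cancel2 zero_le_one)
  moreover from this have "0 < sqrt (1 + (cmod q)\<^sup>2)" by linarith
  ultimately have "2 / sqrt (1 + (cmod q)\<^sup>2) < 1 / 10" by (simp add: pos_divide_less_eq)
  then have c1: "chordal (Some q) None < 1 / 10" by simp
  have c2: "chordal (Some q) (g (Some z')) < 1 / 10"
    using N[OF _ z'd(2), of j] by (simp add: j_def q_def ext_sphere_def)
  have c3: "chordal (Some (Q z')) (g (Some z')) < 1 / 10"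
    using N[OF _ z'd(2), of N] by (simp add: Q_def ext_sphere_def)
  have c4: "chordal (Some (Q z')) (Some (Q z)) < 1 / 10"
    using chordal_le[of "Q z'" "Q z"] d(2)[OF z'd(1)] by linarith
  have "cmod (Q z) \<le> 3" using z by (auto simp: nonescaping_def Q_def)
  then have "sqrt (1 + (cmod (Q z))\<^sup>2) \<le> 4" using sqrt_one_plus_power2_le[of "cmod (Q z)"] by simp
  moreover have "0 < sqrt (1 + (cmod (Q z))\<^sup>2)" by (simp add: add_pos_nonneg)
  ultimately have "1 / 2 \<le> 2 / sqrt (1 + (cmod (Q z))\<^sup>2)" by (simp add: field_simps)
  then have c5: "1 / 2 \<le> chordal (Some (Q z)) None" by simp
  show False
    using c1 c2 c3 c4 c5 dist_triangle[of "sph (Some (Q z))" "sph None" "sph (Some (Q z'))"]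
      dist_triangle[of "sph (Some (Q z'))" "sph None" "sph (g (Some z'))"]
      dist_triangle[of "sph (g (Some z'))" "sph None" "sph (Some q)"]
    unfolding chordal_eq_dist by (simp add: dist_commute)
qed

end

section \<open>Iterating near a parabolic fixed point\<close>

text \<open>A point outside a sector about the negative real axis cannot come near 0 when it moves
  to the right. After squaring, with s = |\<xi>|, this rests on the identity \<kappa>/2 (s + x)^2 +
  (1 - \<kappa>/2) (s - x)^2 = s^2 + x^2 - 2 (1 - \<kappa>) s x.\<close>

lemma cmod_add_real_ge:
  fixes \<xi> :: complex
  assumes "0 < \<kappa>" "\<kappa> \<le> 1" "0 \<le> x" "- (1 - \<kappa>) * cmod \<xi> \<le> Re \<xi>"
  shows "sqrt (\<kappa> / 2) * (cmod \<xi> + x) \<le> cmod (\<xi> + of_real x)"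
proof -
  have "(sqrt (\<kappa> / 2) * (cmod \<xi> + x))\<^sup>2 = \<kappa> / 2 * (cmod \<xi> + x)\<^sup>2"
    using assms by (simp add: power_mult_distrib)
  also have "\<dots> \<le> \<kappa> / 2 * (cmod \<xi> + x)\<^sup>2 + (1 - \<kappa> / 2) * (cmod \<xi> - x)\<^sup>2"
    using assms by simp
  also have "\<dots> = (cmod \<xi>)\<^sup>2 + 2 * x * (- (1 - \<kappa>) * cmod \<xi>) + x\<^sup>2"
    by (simp add: power2_eq_square field_simps)
  also have "\<dots> \<le> (cmod \<xi>)\<^sup>2 + 2 * x * Re \<xi> + x\<^sup>2"
    using mult_left_mono[OF assms(4), of "2 * x"] assms(3) by linarith
  also have "\<dots> = (cmod (\<xi> + of_real x))\<^sup>2"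
    by (simp add: cmod_power2) (simp add: power2_eq_square algebra_simps)
  finally show ?thesis
    by (rule power2_le_imp_le) simp
qed

text \<open>A bootstrap. While X = -1/w has drifted from the pure translation by at most c L / 4,
  the separation \<open>sep\<close> keeps its distance from the sign \<sigma> at least c (L + d) /
  2, so the next step adds a drift of at most 2 / (c (L + d)). By \<open>H\<close> the total never
  exceeds the allowance, which closes the induction; \<open>4 \<le> c * L\<close> absorbs the shift
  by \<sigma>.

  The quotient in the third claim is the logarithmic derivative of the map w 0 -> w k, which governs
  its effect on the radial line field. In terms of X and its initial value \<xi> it equals \<xi> / X
  times dX / d\<xi>, and the latter is the product of the derivatives of the steps.\<close>

lemma near_translation_orbit:
  fixes w D :: "nat \<Rightarrow> complex" and \<sigma> d :: "nat \<Rightarrow> real"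
  assumes w: "\<And>k. w (Suc k) = w k * (1 + of_real (\<sigma> k) * w k)"
    and D: "\<And>k. D (Suc k) = D k * (1 + 2 * of_real (\<sigma> k) * w k)" and D0: "D 0 = 1"
    and \<sigma>: "\<And>k. \<bar>\<sigma> k\<bar> = 1"
    and d: "\<And>k. d (Suc k) = d k + \<sigma> k" "d 0 = 0" "\<And>k. k \<le> N \<Longrightarrow> 0 \<le> d k"
    and w0: "w 0 \<noteq> 0" "cmod (w 0) \<le> 1 / L"
    and L: "4 \<le> c * L" "0 < c" "0 < L"
    and sep: "\<And>x. 0 \<le> x \<Longrightarrow> c * (cmod (- 1 / w 0) + x) \<le> cmod (- 1 / w 0 + of_real x)"
    and H: "2 / c * (\<Sum>i<N. 1 / (L + d i)) \<le> c * L / 4"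
    and k: "k \<le> N"
  shows "w k \<noteq> 0"
    and "cmod (- 1 / w k - (- 1 / w 0) - of_real (d k)) \<le> 2 / c * (\<Sum>i<k. 1 / (L + d i))"
    and "\<exists>x. w 0 * D k / w k = (- 1 / w 0) / (- 1 / w k) * (\<Prod>i<k. 1 + x i) \<and>
             (\<forall>i<k. cmod (x i) \<le> 4 / (c\<^sup>2 * L) * (1 / (L + d i)))"
proof -
  define \<xi> where "\<xi> = - 1 / w 0"
  \<comment> \<open>In this coordinate the step becomes X' = X + s + 1 / (X - s), with derivative 1 - 1 / (X - s)^2.\<close>
  define X where "X = (\<lambda>k. - 1 / w k)"
  have L\<xi>: "L \<le> cmod \<xi>"
    using w0 L unfolding \<xi>_def by (simp add: norm_divide field_simps)
  have step: "w (Suc k) \<noteq> 0 \<and> X (Suc k) = X k + \<sigma> k + 1 / (X k - \<sigma> k) \<and> cmod (1 / (X k - \<sigma> k)) \<le> 2 / c * (1 / (L + d k))"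
    if wk: "w k \<noteq> 0" and Xk: "cmod (X k - \<xi> - of_real (d k)) \<le> c * L / 4" and kN: "k \<le> N" for k
  proof -
    have dk: "0 \<le> d k" using d kN by auto
    have cL: "c * L \<le> c * (cmod \<xi> + d k)" using L\<xi> L dk by (intro mult_left_mono) auto
    have "c * (cmod \<xi> + d k) \<le> cmod (\<xi> + of_real (d k))"
      using sep[OF dk] by (simp add: \<xi>_def)
    moreover have "cmod (\<xi> + of_real (d k)) \<le> cmod (X k - of_real (\<sigma> k)) + cmod (of_real (\<sigma> k)) + cmod (X k - \<xi> - of_real (d k))"
    proof -
      have e: "\<xi> + of_real (d k) = (X k - of_real (\<sigma> k)) + of_real (\<sigma> k) - (X k - \<xi> - of_real (d k))" by simp
      show ?thesis by (subst e) (intro norm_triangle_le_diff norm_triangle_ineq add_right_mono order_trans[OF norm_triangle_ineq4])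
    qed
    moreover have "cmod (of_real (\<sigma> k)) = 1" using \<sigma> by simp
    ultimately have ge: "c * (cmod \<xi> + d k) / 2 \<le> cmod (X k - of_real (\<sigma> k))"
      using Xk cL L(1) by linarith
    have ge': "c * (L + d k) / 2 \<le> cmod (X k - of_real (\<sigma> k))"
      using ge L\<xi> L by (smt (verit) mult_left_mono divide_right_mono)
    have pos: "0 < c * (L + d k) / 2" using L dk by simp
    have nz: "X k - of_real (\<sigma> k) \<noteq> 0" using ge' pos by auto
    have \<sigma>2: "complex_of_real (\<sigma> k) * of_real (\<sigma> k) = 1" using \<sigma>[of k]
      by (metis abs_mult_self_eq mult_1 of_real_1 of_real_mult)
    have nz2: "1 + of_real (\<sigma> k) * w k \<noteq> 0"
      using nz wk unfolding X_def
      by (auto simp: field_simps add_eq_0_iff)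
    have w1: "w (Suc k) \<noteq> 0" using nz2 wk w by simp
    have e1: "X k - of_real (\<sigma> k) = X k * (1 + of_real (\<sigma> k) * w k)" using wk by (simp add: X_def field_simps)
    have "X (Suc k) * (X k - \<sigma> k) = X k * X k"
      unfolding e1 using nz2 wk by (simp add: X_def w)
    moreover have "(X k + \<sigma> k + 1 / (X k - \<sigma> k)) * (X k - \<sigma> k) = X k * X k"
      using nz \<sigma>2 by (simp add: algebra_simps add_divide_distrib diff_divide_distrib)
    ultimately have "X (Suc k) = X k + \<sigma> k + 1 / (X k - \<sigma> k)" using nz
      by (metis mult_right_cancel)
    moreover have "cmod (1 / (X k - \<sigma> k)) \<le> 2 / c * (1 / (L + d k))"
    proof -
      have "cmod (1 / (X k - \<sigma> k)) \<le> 1 / (c * (L + d k) / 2)"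
        unfolding norm_divide norm_one using pos ge' by (intro divide_left_mono mult_pos_pos) linarith+
      then show ?thesis by simp
    qed
    ultimately show ?thesis using w1 by blast
  qed
  have mono: "2 / c * (\<Sum>i<k. 1 / (L + d i)) \<le> c * L / 4" if "k \<le> N" for k
  proof -
    have "(\<Sum>i<k. 1 / (L + d i)) \<le> (\<Sum>i<N. 1 / (L + d i))"
      using that d(3) L by (intro sum_mono2) (auto intro!: divide_nonneg_nonneg add_nonneg_nonneg)
    then have "2 / c * (\<Sum>i<k. 1 / (L + d i)) \<le> 2 / c * (\<Sum>i<N. 1 / (L + d i))"
      using L by (intro mult_left_mono) auto
    then show ?thesis using H by linarith
  qed
  have main: "w k \<noteq> 0 \<and> cmod (X k - \<xi> - of_real (d k)) \<le> 2 / c * (\<Sum>i<k. 1 / (L + d i))" if "k \<le> N" for k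
    using that
  proof (induction k)
    case 0 then show ?case using w0 d(2) by (simp add: X_def \<xi>_def)
  next
    case (Suc k)
    then have IH: "w k \<noteq> 0" "cmod (X k - \<xi> - of_real (d k)) \<le> 2 / c * (\<Sum>i<k. 1 / (L + d i))" by auto
    note s = step[OF IH(1) order_trans[OF IH(2) mono]] 
    have "X (Suc k) - \<xi> - of_real (d (Suc k)) = (X k - \<xi> - of_real (d k)) + 1 / (X k - \<sigma> k)"
      using s Suc.prems d by simp
    then have "cmod (X (Suc k) - \<xi> - of_real (d (Suc k))) \<le> cmod (X k - \<xi> - of_real (d k)) + cmod (1 / (X k - \<sigma> k))"
      by (metis norm_triangle_ineq)
    also have "\<dots> \<le> 2 / c * (\<Sum>i<k. 1 / (L + d i)) + 2 / c * (1 / (L + d k))"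
      using s IH Suc.prems by (intro add_mono) auto
    finally show ?case using s Suc.prems by (simp add: distrib_left)
  qed
  show "w k \<noteq> 0" "cmod (- 1 / w k - (- 1 / w 0) - of_real (d k)) \<le> 2 / c * (\<Sum>i<k. 1 / (L + d i))"
    using main[OF k] by (auto simp: X_def \<xi>_def)
  define x where "x = (\<lambda>i. - (1 / (X i - of_real (\<sigma> i)))\<^sup>2)"
  have xb: "cmod (x i) \<le> 4 / (c\<^sup>2 * L) * (1 / (L + d i))" if "i < k" for i
  proof -
    have i: "i \<le> N" using that k by simp
    have b: "cmod (1 / (X i - of_real (\<sigma> i))) \<le> 2 / c * (1 / (L + d i))"
      using step[OF _ order_trans[OF _ mono]] main[OF i] i by blast
    have di: "0 \<le> d i" using d i by auto
    have "cmod (x i) = (cmod (1 / (X i - of_real (\<sigma> i))))\<^sup>2" by (simp add: x_def norm_power)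
    also have "\<dots> \<le> (2 / c * (1 / (L + d i)))\<^sup>2" by (rule power_mono[OF b]) simp
    also have "\<dots> = 4 / c\<^sup>2 * (1 / (L + d i)) * (1 / (L + d i))" by (simp add: power2_eq_square)
    \<comment> \<open>One of the two factors 1 / (L + d i) is weakened to 1 / L, so that the sum
      that controls the drift also controls the derivative.\<close>
    also have "\<dots> \<le> 4 / c\<^sup>2 * (1 / L) * (1 / (L + d i))"
      using L di by (intro mult_right_mono mult_left_mono divide_left_mono) auto
    finally show ?thesis by simp
  qed
  have "w 0 * D k / w k = \<xi> / X k * (\<Prod>i<k. 1 + x i)" if "k \<le> N" for k
    using that
  proof (induction k)
    case 0 then show ?case using w0 D0 by (simp add: X_def \<xi>_def)
  next
    case (Suc k)
    have m: "w k \<noteq> 0" "w (Suc k) \<noteq> 0" using main Suc.prems by auto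
    have nz: "1 + of_real (\<sigma> k) * w k \<noteq> 0" using m w[of k] by auto
    have \<sigma>2: "complex_of_real (\<sigma> k) ^ 2 = 1" using \<sigma>[of k]
      by (metis of_real_1 of_real_power power2_abs one_power2)
    have e1: "X k - of_real (\<sigma> k) = - (1 + of_real (\<sigma> k) * w k) / w k" using m by (simp add: X_def field_simps)
    have "1 + x k = (1 + 2 * of_real (\<sigma> k) * w k) / (1 + of_real (\<sigma> k) * w k)^2"
    proof -
      have "1 + x k = ((1 + of_real (\<sigma> k) * w k)^2 - (w k)^2) / (1 + of_real (\<sigma> k) * w k)^2"
      proof -
        have "x k = - ((w k)^2 / (1 + of_real (\<sigma> k) * w k)^2)"
          unfolding x_def e1 by (simp only: divide_divide_eq_right power_divide power2_minus mult_1_left mult_minus_left divide_minus_left divide_minus_right minus_minus)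
        then show ?thesis using nz by (simp add: diff_divide_distrib)
      qed
      also have "(1 + of_real (\<sigma> k) * w k)^2 - (w k)^2 = 1 + 2 * of_real (\<sigma> k) * w k + (of_real (\<sigma> k) ^ 2 - 1) * (w k)^2"
        by (simp add: power2_eq_square algebra_simps)
      finally show ?thesis using \<sigma>2 by simp
    qed
    moreover have "X k / X (Suc k) = 1 + of_real (\<sigma> k) * w k" using m nz by (simp add: X_def w)
    ultimately have e: "X k / X (Suc k) * (1 + x k) = (1 + 2 * of_real (\<sigma> k) * w k) / (1 + of_real (\<sigma> k) * w k)"
      using nz by (simp add: power2_eq_square)
    have "w 0 * D (Suc k) / w (Suc k) = w 0 * D k / w k * ((1 + 2 * of_real (\<sigma> k) * w k) / (1 + of_real (\<sigma> k) * w k))"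
      by (simp add: D w)
    also have "\<dots> = \<xi> / X k * (\<Prod>i<k. 1 + x i) * (X k / X (Suc k) * (1 + x k))"
      using Suc e by simp
    also have "\<dots> = \<xi> / X (Suc k) * (\<Prod>i<Suc k. 1 + x i)"
      using m by (simp add: X_def)
    finally show ?case .
  qed
  then show "\<exists>x. w 0 * D k / w k = (- 1 / w 0) / (- 1 / w k) * (\<Prod>i<k. 1 + x i) \<and>
             (\<forall>i<k. cmod (x i) \<le> 4 / (c\<^sup>2 * L) * (1 / (L + d i)))"
    using xb k by (auto simp: \<xi>_def X_def)
qed

section \<open>Slit blocks: out along the slit and back\<close>

definition slit_sign :: "nat \<Rightarrow> nat \<Rightarrow> real" where
  "slit_sign n k = (if k < n then 1 else -1)"

definition slit_block :: "complex \<Rightarrow> nat \<Rightarrow> complex poly list" where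
  "slit_block a n = map (\<lambda>k. [:0, 1, of_real (slit_sign n k) * a:]) [0..<2 * n]"

lemma harm_le_one_plus_ln: "0 < n \<Longrightarrow> harm n \<le> 1 + ln (real n)"
  using euler_mascheroni_sequence_decreasing[of 1 n] by (simp add: harm_expand)

lemma norm_prod_one_plus_diff_le:
  fixes x :: "nat \<Rightarrow> complex"
  shows "cmod ((\<Prod>i<k. 1 + x i) - 1) \<le> exp (\<Sum>i<k. cmod (x i)) - 1"
proof (induction k)
  case (Suc k)
  let ?p = "\<Prod>i<k. 1 + x i" and ?s = "\<Sum>i<k. cmod (x i)"
  have "(\<Prod>i<Suc k. 1 + x i) - 1 = (?p - 1) * (1 + x k) + x k" by (simp add: algebra_simps)
  then have "cmod ((\<Prod>i<Suc k. 1 + x i) - 1) \<le> cmod (?p - 1) * cmod (1 + x k) + cmod (x k)"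
    by (metis norm_mult norm_triangle_ineq)
  also have "\<dots> \<le> (exp ?s - 1) * (1 + cmod (x k)) + cmod (x k)"
    using Suc norm_triangle_ineq[of 1 "x k"] by (intro add_mono mult_mono) (auto simp: sum_nonneg)
  also have "\<dots> = exp ?s * (1 + cmod (x k)) - 1" by (simp add: algebra_simps)
  also have "\<dots> \<le> exp ?s * exp (cmod (x k)) - 1" by simp
  finally show ?case by (simp add: exp_add)
qed simp

text \<open>The displacement runs from 0 to n and back, so each half contributes at most a harmonic
  sum. Growth that is only logarithmic in n is what allows very long blocks.\<close>

lemma sum_slit_positions_le:
  assumes "1 \<le> (L::real)"
  shows "(\<Sum>i<2 * n. 1 / (L + (if i \<le> n then real i else 2 * real n - real i))) \<le> 2 * harm n"
    (is "(\<Sum>i<2 * n. ?f i) \<le> _")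
proof -
  have "(\<Sum>i<2 * n. ?f i) = (\<Sum>i<n. ?f i) + (\<Sum>i\<in>{n..<2 * n}. ?f i)"
    using sum.atLeastLessThan_concat[of 0 n "2 * n" ?f] by (simp add: lessThan_atLeast0)
  also have "(\<Sum>i\<in>{n..<2 * n}. ?f i) = (\<Sum>j<n. 1 / (L + real (Suc j)))"
    by (rule sum.reindex_bij_witness[of _ "\<lambda>j. 2 * n - Suc j" "\<lambda>i. 2 * n - Suc i"])
       (auto simp: of_nat_diff)
  also have "(\<Sum>i<n. ?f i) = (\<Sum>j<n. 1 / (L + real j))" by simp
  also have "\<dots> \<le> (\<Sum>j<n. 1 / real (Suc j))"
    using assms by (intro sum_mono divide_left_mono) auto
  also have "(\<Sum>j<n. 1 / (L + real (Suc j))) \<le> (\<Sum>j<n. 1 / real (Suc j))"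
    using assms by (intro sum_mono divide_left_mono) auto
  also have "(\<Sum>j<n. 1 / real (Suc j)) = harm n"
    unfolding harm_def by (rule sum.reindex_bij_witness[of _ "\<lambda>j. j - 1" Suc]) (auto simp: field_simps)
  finally show ?thesis by simp
qed

text \<open>The condition on Re (a w) keeps X = -1 / (a w) off a sector about the negative axis, so
  the translation out and back avoids 0. The displacements cancel, hence X returns to its start
  \<xi> up to an error of at most q |\<xi>|, and the product of the derivatives is within 2 q of 1.
  Dividing 3 q |\<xi>| by |X|, which is at least 3/4 |\<xi>|, gives 4 q. With c^2 = \<kappa> / 2,
  the factor 16 in q makes the drift bound 4 \<open>harm n\<close> / c equal to q c L / 2.\<close>

lemma slit_block_near_identity:
  fixes a w :: complex
  assumes a: "cmod a = 1" and w0: "w \<noteq> 0" "cmod w \<le> 1 / L"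
    and \<kappa>: "0 < \<kappa>" "\<kappa> \<le> 1" "Re (a * w) \<le> (1 - \<kappa>) * cmod w"
    and L: "4 \<le> sqrt (\<kappa> / 2) * L" and L0: "0 < L" and q: "q = 16 * harm n / (\<kappa> * L)" "q \<le> 1 / 4"
  defines "F \<equiv> fold poly (slit_block a n)"
  shows "\<exists>F'. (F has_field_derivative F') (at w) \<and> F w \<noteq> 0 \<and> cmod (F w) < 1 / 2 \<and> cmod (w * F' / F w - 1) \<le> 4 * q"
proof -
  define c where "c = sqrt (\<kappa> / 2)"
  have c: "0 < c" "c \<le> 1" "c\<^sup>2 = \<kappa> / 2" using \<kappa>(1,2) by (auto simp: c_def)
  have L4: "4 \<le> L" using L mult_right_mono[OF c(2), of L] L0 unfolding c_def by linarith
  define \<sigma> where "\<sigma> = slit_sign n"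
  define d where "d = (\<lambda>k. if k \<le> n then real k else 2 * real n - real k)"
  \<comment> \<open>The orbit multiplied by \<open>a\<close>: this turns z + s a z^2 into v (1 + s
    v) and rotates the slit onto the positive real axis.\<close>
  define W where "W = (\<lambda>u k. rec_nat (a * u) (\<lambda>k v. v * (1 + of_real (\<sigma> k) * v)) k)"
  define D where "D = (\<lambda>k. rec_nat 1 (\<lambda>k v. v * (1 + 2 * of_real (\<sigma> k) * W w k)) k)"
  have W0: "W u 0 = a * u" and WS: "W u (Suc k) = W u k * (1 + of_real (\<sigma> k) * W u k)" for u k
    by (simp_all add: W_def)
  have D0: "D 0 = 1" and DS: "D (Suc k) = D k * (1 + 2 * of_real (\<sigma> k) * W w k)" for k
    by (simp_all add: D_def)
  have a0: "a \<noteq> 0" using a by auto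
  let ?l = "\<lambda>k. map (\<lambda>k. [:0, 1, of_real (\<sigma> k) * a:]) [0..<k]"
  have fold: "fold poly (?l k) u = W u k / a" for u k
  proof (induction k)
    case 0 show ?case using a0 by (simp add: W0)
  next
    case (Suc k)
    have "fold poly (?l (Suc k)) u = poly [:0, 1, of_real (\<sigma> k) * a:] (fold poly (?l k) u)"
      by (simp only: upt_Suc_append[OF le0] map_append fold_append list.map fold_simps o_apply)
    also have "\<dots> = W u (Suc k) / a" unfolding Suc.IH WS using a0 by (simp add: field_simps)
    finally show ?case .
  qed
  have der: "((\<lambda>u. fold poly (?l k) u) has_field_derivative D k) (at w)" for k
  proof (induction k)
    case 0 then show ?case by (simp add: D0)
  next
    case (Suc k)
    have "poly (pderiv [:0, 1, of_real (\<sigma> k) * a:]) (fold poly (?l k) w) = 1 + 2 * of_real (\<sigma> k) * W w k"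
      unfolding fold pderiv_pCons using a0 by (simp add: algebra_simps)
    moreover have "((\<lambda>u. poly [:0, 1, of_real (\<sigma> k) * a:] (fold poly (?l k) u)) has_field_derivative
        poly (pderiv [:0, 1, of_real (\<sigma> k) * a:]) (fold poly (?l k) w) * D k) (at w)"
      using DERIV_chain2[where f = "poly [:0, 1, of_real (\<sigma> k) * a:]", OF poly_DERIV Suc] .
    moreover have "(\<lambda>u. fold poly (?l (Suc k)) u) = (\<lambda>u. poly [:0, 1, of_real (\<sigma> k) * a:] (fold poly (?l k) u))"
      by (simp only: upt_Suc_append[OF le0] map_append fold_append list.map fold_simps o_apply)
    ultimately show ?case by (simp only: DS mult.commute)
  qed
  have sep: "c * (cmod (- 1 / W w 0) + x) \<le> cmod (- 1 / W w 0 + of_real x)" if "0 \<le> x" for x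
    unfolding c_def
  proof (rule cmod_add_real_ge[OF \<kappa>(1,2) that])
    have e: "Re (- 1 / (a * w)) = - Re (a * w) / (cmod w)\<^sup>2"
    proof -
      have "Re (- 1 / (a * w)) = - Re (a * w) / (cmod (a * w))\<^sup>2"
        unfolding Re_divide cmod_power2 by simp
      then show ?thesis using a by (simp add: norm_mult)
    qed
    have "(1 - \<kappa>) * cmod (- 1 / (a * w)) = (1 - \<kappa>) * cmod w / (cmod w)\<^sup>2"
      using a w0 by (simp add: norm_divide norm_mult power2_eq_square)
    also have "\<dots> \<ge> Re (a * w) / (cmod w)\<^sup>2" using \<kappa>(3) by (intro divide_right_mono) auto
    finally show "- (1 - \<kappa>) * cmod (- 1 / W w 0) \<le> Re (- 1 / W w 0)"
      unfolding W0 e by linarith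
  qed
  have sum: "(\<Sum>i<2 * n. 1 / (L + d i)) \<le> 2 * harm n"
    unfolding d_def by (rule sum_slit_positions_le) (use L4 in simp)
  have qH: "8 * harm n = q * (c\<^sup>2 * L)" unfolding c(3) using q(1) \<kappa>(1) L0 by (simp add: field_simps)
  have H: "2 / c * (\<Sum>i<2 * n. 1 / (L + d i)) \<le> q * (c * L) / 2"
  proof -
    have "2 / c * (\<Sum>i<2 * n. 1 / (L + d i)) \<le> 2 / c * (2 * harm n)"
      using sum c by (intro mult_left_mono) auto
    also have "\<dots> = 8 * harm n / (2 * c)" by simp
    also have "\<dots> = q * (c * L) / 2" unfolding qH using c by (simp add: power2_eq_square)
    finally show ?thesis .
  qed
  have q0: "0 \<le> q" unfolding q(1) using \<kappa>(1) L0 by (simp add: harm_nonneg)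
  have qcL: "q * (c * L) / 2 \<le> c * L / 4" using mult_right_mono[OF q(2), of "c * L"] c(1) L0 by simp
  have *: "cmod (W w 0) \<le> 1 / L" "W w 0 \<noteq> 0" using a a0 w0 by (auto simp: W0 norm_mult)
  have \<sigma>: "\<bar>\<sigma> k\<bar> = 1" "d (Suc k) = d k + \<sigma> k" for k
    by (auto simp: \<sigma>_def slit_sign_def d_def)
  have d: "d 0 = 0" "\<And>k. k \<le> 2 * n \<Longrightarrow> 0 \<le> d k" "d (2 * n) = 0" by (auto simp: d_def)
  have L': "4 \<le> c * L" using L by (simp add: c_def)
  note N = near_translation_orbit[where w = "W w" and \<sigma> = \<sigma> and D = D and d = d and N = "2 * n" and k = "2 * n",
      OF WS DS D0 \<sigma> d(1,2) *(2,1) L' c(1) L0 sep order_trans[OF H qcL] order_refl]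
  define \<xi> where "\<xi> = - 1 / W w 0"
  define X where "X = - 1 / W w (2 * n)"
  obtain x where x: "W w 0 * D (2 * n) / W w (2 * n) = \<xi> / X * (\<Prod>i<2 * n. 1 + x i)"
    "\<And>i. i < 2 * n \<Longrightarrow> cmod (x i) \<le> 4 / (c\<^sup>2 * L) * (1 / (L + d i))"
    using N(3) unfolding \<xi>_def X_def by metis
  have "cmod (X - \<xi>) \<le> q * (c * L) / 2"
    using order_trans[OF N(2) H] d(3) by (simp add: \<xi>_def X_def)
  also have "\<dots> \<le> q * L" using c q0 L0 mult_left_mono[OF c(2), of "q * L"] by (simp add: mult_ac) 
  also have L\<xi>: "L \<le> cmod \<xi>"
    using * L0 unfolding \<xi>_def by (simp add: norm_divide field_simps)
  then have "q * L \<le> q * cmod \<xi>" using q0 by (rule mult_left_mono)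
  finally have X\<xi>: "cmod (X - \<xi>) \<le> q * cmod \<xi>" .
  have Xge: "(1 - q) * cmod \<xi> \<le> cmod X"
    using norm_triangle_ineq2[of \<xi> "\<xi> - X"] X\<xi> by (simp add: norm_minus_commute algebra_simps)
  have "3 \<le> (1 - q) * cmod \<xi>" using L4 L\<xi> q mult_mono[of "3/4" "1 - q" 4 "cmod \<xi>"] by simp
  with Xge have X3: "3 \<le> cmod X" by linarith
  have W3: "W w (2 * n) = - 1 / X" using N(1) by (simp add: X_def)
  have \<xi>0: "\<xi> \<noteq> 0" "X \<noteq> 0" using L\<xi> L0 X3 by auto
  have "cmod ((\<Prod>i<2 * n. 1 + x i) - 1) \<le> exp (\<Sum>i<2 * n. cmod (x i)) - 1"
    by (rule norm_prod_one_plus_diff_le)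
  also have "(\<Sum>i<2 * n. cmod (x i)) \<le> (\<Sum>i<2 * n. 4 / (c\<^sup>2 * L) * (1 / (L + d i)))"
    using x by (intro sum_mono) auto
  also have "\<dots> = 4 / (c\<^sup>2 * L) * (\<Sum>i<2 * n. 1 / (L + d i))" by (simp add: sum_distrib_left)
  also have "\<dots> \<le> 4 / (c\<^sup>2 * L) * (2 * harm n)" using sum c L0 by (intro mult_left_mono) auto
  also have "\<dots> = 8 * harm n / (c\<^sup>2 * L)" by simp
  also have "\<dots> = q" unfolding qH using c(1) L0 by simp
  also have "exp q - 1 \<le> 2 * q" using exp_bound_lemma[of q] q(2) q0 by simp
  finally have \<phi>: "cmod ((\<Prod>i<2 * n. 1 + x i) - 1) \<le> 2 * q" by simp
  let ?p = "\<Prod>i<2 * n. 1 + x i"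
  have "\<xi> / X * ?p - 1 = (\<xi> * (?p - 1) - (X - \<xi>)) / X" using \<xi>0 by (simp add: field_simps)
  also have "cmod \<dots> \<le> (cmod \<xi> * (2 * q) + q * cmod \<xi>) / cmod X"
    unfolding norm_divide
  proof (rule divide_right_mono)
    have "cmod (\<xi> * (?p - 1)) \<le> cmod \<xi> * (2 * q)" unfolding norm_mult using \<phi> by (rule mult_left_mono) simp
    then show "cmod (\<xi> * (?p - 1) - (X - \<xi>)) \<le> cmod \<xi> * (2 * q) + q * cmod \<xi>"
      using norm_triangle_ineq4[of "\<xi> * (?p - 1)" "X - \<xi>"] X\<xi> by linarith
  qed simp
  also have "\<dots> = 3 * q * cmod \<xi> / cmod X" by (simp add: algebra_simps)
  also have "\<dots> \<le> 3 * q * cmod \<xi> / (3 / 4 * cmod \<xi>)"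
  proof (intro divide_left_mono)
    show "3 / 4 * cmod \<xi> \<le> cmod X" using Xge q mult_right_mono[of "3/4" "1 - q" "cmod \<xi>"] by simp
  qed (use q0 \<xi>0 in auto)
  also have "\<dots> = 4 * q" using \<xi>0 by simp
  finally have \<Lambda>: "cmod (W w 0 * D (2 * n) / W w (2 * n) - 1) \<le> 4 * q" using x by simp
  have F: "F = (\<lambda>u. fold poly (?l (2 * n)) u)" "F w = W w (2 * n) / a"
    using fold[of "2 * n" w] by (auto simp: F_def slit_block_def \<sigma>_def)
  show ?thesis
  proof (intro exI conjI)
    show "(F has_field_derivative D (2 * n)) (at w)" unfolding F by (rule der)
    have "cmod (F w) = 1 / cmod X" unfolding F(2) W3 using a by (simp add: norm_divide norm_mult)
    then show "F w \<noteq> 0" "cmod (F w) < 1 / 2" using X3 by (auto simp: divide_less_eq)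
    show "cmod (w * D (2 * n) / F w - 1) \<le> 4 * q" using \<Lambda> a0 by (simp add: F(2) W0 mult_ac)
  qed
qed

section \<open>Blocks\<close>

text \<open>Beltrami coefficient exp (2 i arg z) of the field of radial lines. Division by zero
  makes it 0 at the origin, so preimages of the origin are discarded as null sets.\<close>

definition radial :: "complex \<Rightarrow> complex" where
  "radial z = z / cnj z"

lemma pullback_comp:
  assumes "f field_differentiable at z" "g field_differentiable at (f z)"
  shows "pullback (g \<circ> f) \<mu> z = pullback f (pullback g \<mu>) z"
  using assms by (simp add: pullback_def deriv_chain)

text \<open>The factor cnj f' / f' has modulus 1, or is 0 at a critical point. Errors made in late
  blocks are therefore carried back to early times without growth.\<close>

lemma norm_pullback_diff_le: "cmod (pullback f \<mu> z - pullback f \<nu> z) \<le> cmod (\<mu> (f z) - \<nu> (f z))"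
proof -
  have "pullback f \<mu> z - pullback f \<nu> z = (\<mu> (f z) - \<nu> (f z)) * (cnj (deriv f z) / deriv f z)"
    by (simp add: pullback_def diff_divide_distrib left_diff_distrib)
  also have "cmod \<dots> = cmod (\<mu> (f z) - \<nu> (f z)) * (if deriv f z = 0 then 0 else 1)"
    by (simp add: norm_mult norm_divide)
  finally show ?thesis by simp
qed

lemma pullback_power_radial:
  assumes "z \<noteq> 0" "0 < M"
  shows "pullback (\<lambda>z. z ^ M) radial z = radial z"
proof -
  obtain k where k: "M = Suc k" using assms(2) gr0_implies_Suc by blast
  have "((\<lambda>z. z ^ M) has_field_derivative of_nat M * z ^ k) (at z)"
    using DERIV_power[OF DERIV_ident, of M z UNIV] by (simp add: k del: of_nat_Suc)
  then have "deriv (\<lambda>z. z ^ M) z = of_nat M * z ^ k" by (rule DERIV_imp_deriv)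
  moreover have "of_nat M \<noteq> (0::complex)" using assms(2) by simp
  ultimately show ?thesis
    using assms by (simp add: pullback_def radial_def k del: of_nat_Suc)
qed

text \<open>With \<Lambda> = w F' / F w the pulled back field is the radial one times cnj \<Lambda>
  / \<Lambda>, so it suffices that \<Lambda> is close to 1.\<close>

lemma pullback_radial_near:
  assumes F: "(F has_field_derivative F') (at w)" and nz: "w \<noteq> 0" "F w \<noteq> 0"
    and \<Lambda>: "cmod (w * F' / F w - 1) \<le> t" "t \<le> 1 / 2"
  shows "cmod (pullback F radial w - radial w) \<le> 4 * t"
proof -
  define \<Lambda> where "\<Lambda> = w * F' / F w"
  have l: "1 - t \<le> cmod \<Lambda>" using \<Lambda>(1) norm_triangle_ineq2[of 1 "1 - \<Lambda>"]
    by (simp add: \<Lambda>_def norm_minus_commute)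
  then have \<Lambda>0: "\<Lambda> \<noteq> 0" "1 / 2 \<le> cmod \<Lambda>" using \<Lambda>(2) by auto
  have F': "F' = \<Lambda> * F w / w" using nz by (simp add: \<Lambda>_def)
  have "pullback F radial w - radial w = radial w * ((cnj \<Lambda> - \<Lambda>) / \<Lambda>)"
    using nz \<Lambda>0(1) by (simp add: pullback_def radial_def DERIV_imp_deriv[OF F] F' divide_simps) (simp add: algebra_simps)
  also have "cmod \<dots> = cmod (cnj \<Lambda> - \<Lambda>) / cmod \<Lambda>"
    using nz by (simp add: norm_mult norm_divide radial_def)
  also have "cmod (cnj \<Lambda> - \<Lambda>) = cmod (cnj (\<Lambda> - 1) - (\<Lambda> - 1))" by simp
  also have "\<dots> \<le> 2 * t"
    using norm_triangle_ineq4[of "cnj (\<Lambda> - 1)" "\<Lambda> - 1"] \<Lambda>(1) unfolding \<Lambda>_def[symmetric] complex_mod_cnj by linarith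
  also have "2 * t / cmod \<Lambda> \<le> 2 * t / (1 / 2)"
    using \<Lambda>0 order_trans[OF norm_ge_zero \<Lambda>(1)] by (intro divide_left_mono) auto
  finally show ?thesis using \<Lambda>0(2) by (simp add: divide_right_mono)
qed

text \<open>On the slit the first half of the block acts as y -> y + y^2 on the positive axis and
  gains at least x^2 per step, so n steps gain at least 4. The second half consists of maps of the
  same family and cannot undo the escape.\<close>

lemma slit_block_escape:
  assumes a: "cmod a = 1" and w: "a * w = of_real x" "0 < x" and n: "4 / x\<^sup>2 \<le> real n"
  shows "3 < cmod (fold poly (slit_block a n) w)"
proof -
  have a0: "a \<noteq> 0" using a by auto
  have *: "\<exists>y. a * fold poly (map (\<lambda>k. [:0, 1, of_real (slit_sign n k) * a:]) [0..<k]) w = of_real y \<and> x + real k * x\<^sup>2 \<le> y"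
    if "k \<le> n" for k
    using that
  proof (induction k)
    case 0 then show ?case using w by auto
  next
    case (Suc k)
    let ?v = "fold poly (map (\<lambda>k. [:0, 1, of_real (slit_sign n k) * a:]) [0..<k]) w"
    from Suc obtain y where y: "a * ?v = of_real y" "x + real k * x\<^sup>2 \<le> y" by auto
    have "x \<le> y" using y(2) by (smt (verit) mult_nonneg_nonneg of_nat_0_le_iff zero_le_power2)
    then have "x\<^sup>2 \<le> y\<^sup>2" using w(2) by (intro power_mono) auto
    moreover have "a * (?v * (1 + a * ?v)) = of_real (y + y\<^sup>2)"
      unfolding mult.assoc[symmetric] y(1) by (simp add: power2_eq_square algebra_simps)
    ultimately show ?case using Suc.prems y(2)
      by (intro exI[of _ "y + y\<^sup>2"]) (auto simp: slit_sign_def algebra_simps)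
  qed
  obtain y where y: "a * fold poly (map (\<lambda>k. [:0, 1, of_real (slit_sign n k) * a:]) [0..<n]) w = of_real y" "x + real n * x\<^sup>2 \<le> y"
    using * by blast
  have "4 \<le> real n * x\<^sup>2" using n w(2) by (simp add: field_simps)
  then have "3 < y" using y(2) w(2) by linarith
  have "cmod (fold poly (map (\<lambda>k. [:0, 1, of_real (slit_sign n k) * a:]) [0..<n]) w) = \<bar>y\<bar>"
    using arg_cong[OF y(1), of cmod] a by (simp add: norm_mult)
  then have "3 < cmod (fold poly (map (\<lambda>k. [:0, 1, of_real (slit_sign n k) * a:]) [0..<n]) w)"
    using \<open>3 < y\<close> by linarith
  moreover have "set (map (\<lambda>k. [:0, 1, of_real (slit_sign n k) * a:]) [n..<2 * n]) \<subseteq> quads"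
    using a by (auto simp: quads_def slit_sign_def)
  ultimately have "3 < cmod (fold poly (map (\<lambda>k. [:0, 1, of_real (slit_sign n k) * a:]) [n..<2 * n])
      (fold poly (map (\<lambda>k. [:0, 1, of_real (slit_sign n k) * a:]) [0..<n]) w))"
    using fold_escape by blast
  moreover have "[0..<2 * n] = [0..<n] @ [n..<2 * n]" using upt_add_eq_append[of 0 n n] by (simp add: mult_2)
  ultimately show ?thesis by (simp add: slit_block_def)
qed

lemma slit_block_quads: "cmod a = 1 \<Longrightarrow> set (slit_block a n) \<subseteq> quads"
  by (auto simp: slit_block_def quads_def slit_sign_def)

lemma square_quads: "[:0, 0, 1:] \<in> quads"
  unfolding quads_def by force

lemma fold_squares:
  fixes z :: complex
  shows "fold poly (replicate N [:0, 0, 1:]) z = z ^ (2 ^ N)"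
proof (induction N arbitrary: z)
  case (Suc N)
  have "(z * z) ^ (2 ^ N) = z ^ (2 ^ Suc N)" using power_mult[of z 2 "2 ^ N"] by (simp add: power2_eq_square)
  moreover have "fold poly (replicate (Suc N) [:0, 0, 1:]) z = fold poly (replicate N [:0, 0, 1:]) (z * z)" by simp
  ultimately show ?case by (simp only: Suc)
qed simp

section \<open>Choice of sectors, annuli and scales\<close>

text \<open>Let \<delta> be the smallest distance from 1 to another K-th root of unity, capped at 1.
  With \<kappa> = \<delta>^2 / 8, a unit vector of real part above 1 - \<kappa> lies within \<delta>
  / 2 of 1, so a common point of two sectors would bring two roots closer than \<delta>.\<close>

lemma disjoint_sectors:
  fixes K :: nat
  obtains \<kappa> where "0 < \<kappa>" "\<kappa> \<le> 1"
    "\<And>i j u. i < j \<Longrightarrow> j < K \<Longrightarrow> (1 - \<kappa>) * cmod u < Re (cis (2 * pi / K) ^ i * u) \<Longrightarrow>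
       (1 - \<kappa>) * cmod u < Re (cis (2 * pi / K) ^ j * u) \<Longrightarrow> False"
proof -
  define \<omega> where "\<omega> = cis (2 * pi / K)"
  define D where "D = insert 1 ((\<lambda>j. cmod (\<omega> ^ j - 1)) ` {1..<K})"
  have fD: "finite D" "D \<noteq> {}" by (auto simp: D_def)
  have pos: "0 < cmod (\<omega> ^ j - 1)" if "1 \<le> j" "j < K" for j
  proof -
    have "\<omega> ^ j \<noteq> 1"
    proof
      assume e: "\<omega> ^ j = 1"
      have "\<omega> ^ j = cis (2 * pi * j / K)" using Complex.DeMoivre[of "2 * pi / K" j] by (simp add: \<omega>_def mult_ac)
      then have "cos (2 * pi * j / K) = 1" using e by (metis cis.simps(1) one_complex.simps(1))
      then obtain n :: int where "2 * pi * j / K = n * (2 * pi)" using cos_one_2pi_int by (auto simp: mult_ac)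
      then have "real j = real_of_int n * real K" using that by (simp add: field_simps)
      then have "int j = n * int K" by (metis of_int_eq_iff of_int_mult of_int_of_nat_eq)
      then show False using that by (metis dvd_triv_right int_dvd_int_iff nat_dvd_not_less zero_less_one order_less_le_trans)
    qed
    then show ?thesis by simp
  qed
  define \<delta> where "\<delta> = Min D"
  have \<delta>: "0 < \<delta>" "\<delta> \<le> 1" unfolding \<delta>_def using fD pos by (auto simp: D_def)
  have \<delta>j: "\<delta> \<le> cmod (\<omega> ^ j - 1)" if "1 \<le> j" "j < K" for j
    unfolding \<delta>_def using fD that by (intro Min_le) (auto simp: D_def)
  define \<kappa> where "\<kappa> = \<delta>\<^sup>2 / 8"
  have near: "cmod (p - 1) < \<delta> / 2" if "cmod p = 1" "1 - \<kappa> < Re p" for p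
  proof -
    have "(cmod (p - 1))\<^sup>2 = (Re p)\<^sup>2 + (Im p)\<^sup>2 + 1 - 2 * Re p"
      by (simp add: cmod_power2) (simp add: power2_eq_square algebra_simps)
    also have "\<dots> = 2 - 2 * Re p" using that(1) by (simp flip: cmod_power2)
    also have "\<dots> < (\<delta> / 2)\<^sup>2" using that(2) by (simp add: \<kappa>_def power2_eq_square)
    finally show ?thesis by (rule power2_less_imp_less) (use \<delta> in simp)
  qed
  show thesis
  proof (rule that)
    show "0 < \<kappa>" "\<kappa> \<le> 1" using \<delta> power_le_one[of \<delta> 2] by (auto simp: \<kappa>_def)
    fix i j u assume ij: "i < j" "j < K"
      and u: "(1 - \<kappa>) * cmod u < Re (cis (2 * pi / K) ^ i * u)" "(1 - \<kappa>) * cmod u < Re (cis (2 * pi / K) ^ j * u)"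
    have u0: "u \<noteq> 0" using u by auto
    define p where "p = \<omega> ^ i * u / cmod u"
    have \<omega>1: "cmod (\<omega> ^ k) = 1" for k by (simp add: \<omega>_def norm_power)
    have "\<omega> ^ j = \<omega> ^ (j - i) * \<omega> ^ i" using ij by (simp add: power_add[symmetric])
    then have pj: "\<omega> ^ (j - i) * p = \<omega> ^ j * u / cmod u" by (simp add: p_def)
    have Re_div: "Re (v / cmod u) = Re v / cmod u" for v by simp
    have "1 - \<kappa> < Re p" "1 - \<kappa> < Re (\<omega> ^ (j - i) * p)" unfolding pj unfolding p_def Re_div
      using u u0 by (simp_all add: \<omega>_def field_simps)
    moreover have p1: "cmod p = 1" "cmod (\<omega> ^ (j - i) * p) = 1" using u0 \<omega>1 by (simp_all add: p_def norm_mult norm_divide)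
    ultimately have "cmod (p - 1) < \<delta> / 2" "cmod (\<omega> ^ (j - i) * p - 1) < \<delta> / 2" using near by blast+
    moreover have "cmod (\<omega> ^ (j - i) - 1) = cmod (\<omega> ^ (j - i) * p - p)"
      using p1 by (metis left_diff_distrib mult_1 mult_1_right norm_mult)
    moreover have "cmod (\<omega> ^ (j - i) * p - p) \<le> cmod (\<omega> ^ (j - i) * p - 1) + cmod (p - 1)"
      by (metis dist_norm dist_triangle2)
    ultimately have "cmod (\<omega> ^ (j - i) - 1) < \<delta>" by linarith
    moreover have "\<delta> \<le> cmod (\<omega> ^ (j - i) - 1)" by (rule \<delta>j) (use ij in auto)
    ultimately show False by linarith
  qed
qed


lemma bounded_vimage_fold:
  assumes "set l \<subseteq> quads"
  shows "{z. cmod (fold poly l z) \<le> 3} \<subseteq> cball 0 3"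
  using fold_escape[OF assms] by (auto simp: not_less[symmetric])

lemma borel_measurable_fold_poly [measurable]: "(\<lambda>z::complex. fold poly l z) \<in> borel_measurable borel"
  by (rule borel_measurable_continuous_onI[OF holomorphic_on_imp_continuous_on[OF holomorphic_fold_poly]])

lemma fmeasurable_bounded_borel:
  fixes S :: "complex set"
  assumes "S \<in> sets borel" "S \<subseteq> cball 0 3"
  shows "S \<in> lmeasurable"
proof (rule bounded_set_imp_lmeasurable)
  show "bounded S" using assms(2) bounded_cball bounded_subset by blast
  show "S \<in> sets lebesgue" using assms(1) by (metis sets_completionI_sets sets_lborel)
qed

text \<open>Near modulus 1, squaring neither shrinks nor expels points at a definite rate, so these
  points are sacrificed. The preimages of the annuli are bounded and decrease to the preimage of the
  unit circle, which is null.\<close>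

lemma thin_annulus:
  assumes l: "set l \<subseteq> quads" and \<epsilon>: "0 < \<epsilon>"
  obtains r where "1 / 2 < r" "r < 1"
    "{z. r \<le> cmod (fold poly l z) \<and> cmod (fold poly l z) \<le> 1 / r} \<in> lmeasurable"
    "measure lebesgue {z. r \<le> cmod (fold poly l z) \<and> cmod (fold poly l z) \<le> 1 / r} < \<epsilon>"
proof -
  define r where "r = (\<lambda>k. 1 - 1 / (real k + 3))"
  have r: "1 / 2 < r k" "r k < 1" for k by (auto simp: r_def field_simps)
  define A where "A = (\<lambda>k. {z. r k \<le> cmod (fold poly l z) \<and> cmod (fold poly l z) \<le> 1 / r k})"
  have r3: "1 / r k \<le> 3" for k using r[of k] by (simp add: field_simps)
  have "A k \<subseteq> {z. cmod (fold poly l z) \<le> 3}" for k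
    using r3[of k] by (auto simp: A_def)
  then have A3: "A k \<subseteq> cball 0 3" for k using bounded_vimage_fold[OF l] by blast
  have Am: "A k \<in> lmeasurable" for k
    by (rule fmeasurable_bounded_borel[OF _ A3]) (simp add: A_def)
  have rmono: "r j \<le> r k" if "j \<le> k" for j k using that by (auto simp: r_def field_simps)
  have "1 / r k \<le> 1 / r j" if "j \<le> k" for j k
    using rmono[OF that] r[of j] r[of k] by (intro divide_left_mono mult_pos_pos) auto
  then have "A k \<subseteq> A j" if "j \<le> k" for j k
    using rmono[OF that] that unfolding A_def by (blast intro: order_trans)
  then have "decseq A" by (simp add: antimono_def)
  then have "(\<lambda>k. measure lebesgue (A k)) \<longlonglongrightarrow> measure lebesgue (\<Inter>k. A k)"
    by (intro Lim_measure_decseq) (use Am fmeasurableD2[OF Am] in \<open>auto simp del: emeasure_completion\<close>)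
  moreover have "negligible (\<Inter>k. A k)"
  proof (rule negligible_subset)
    show "negligible {z. fold poly l z \<in> sphere 0 1}"
      by (rule negligible_vimage_fold[OF l negligible_sphere])
    have r1: "r \<longlonglongrightarrow> 1" unfolding r_def by real_asymp
    show "(\<Inter>k. A k) \<subseteq> {z. fold poly l z \<in> sphere 0 1}"
    proof
      fix z assume z: "z \<in> (\<Inter>k. A k)"
      have "1 \<le> cmod (fold poly l z)"
        using z by (intro LIMSEQ_le_const2[OF r1]) (auto simp: A_def)
      moreover have "cmod (fold poly l z) \<le> 1 / 1"
        using z by (intro LIMSEQ_le_const[OF tendsto_divide[OF tendsto_const r1]]) (auto simp: A_def)
      ultimately show "z \<in> {z. fold poly l z \<in> sphere 0 1}" by simp
    qed
  qed
  ultimately have "(\<lambda>k. measure lebesgue (A k)) \<longlonglongrightarrow> 0"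
    by (simp add: negligible_imp_measure0)
  then have "\<forall>\<^sub>F k in sequentially. measure lebesgue (A k) < \<epsilon>" using \<epsilon> by (rule order_tendstoD)
  then obtain k where "measure lebesgue (A k) < \<epsilon>" by (auto simp: eventually_sequentially)
  then show thesis using that[of "r k"] r Am[of k] by (simp add: A_def)
qed

text \<open>In M = 2^N the harmonic number is at most 1 + ln 5 + 2 M ln (1 / v), linear, against an
  exponential denominator; the other requirements also hold for all large M. The 5 comes from
  rounding 4 / x^2 up, since 1 / x^2 is at least 1.\<close>

lemma good_scale:
  fixes r v \<kappa> \<epsilon> \<theta> :: real
  assumes "1 / 2 < r" "r < 1" "0 < v" "v < 1" "0 < \<kappa>" "0 < \<epsilon>" "0 < \<theta>"
  obtains N where "0 < N" "r ^ (2 ^ N) < 1 / 2" "3 < (1 / r) ^ (2 ^ N)" "2 * pi / 2 ^ N < \<theta>"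
    "4 \<le> sqrt (\<kappa> / 2) * (1 / r) ^ (2 ^ N)"
    "16 * harm (nat \<lceil>4 / (v ^ (2 ^ N))\<^sup>2\<rceil>) / (\<kappa> * (1 / r) ^ (2 ^ N)) < \<epsilon>"
proof -
  define R where "R = 1 / r"
  have R: "1 < R" using assms by (simp add: R_def field_simps)
  have 1: "\<forall>\<^sub>F M :: nat in sequentially. r ^ M < 1 / 2"
    using assms by (intro order_tendstoD(2)[OF LIMSEQ_power_zero]) auto
  have Rinf: "filterlim (\<lambda>M. R ^ M) at_top sequentially"
    using R by (rule filterlim_realpow_sequentially_gt1[OF _, simplified] | real_asymp)+
  have 2: "\<forall>\<^sub>F M :: nat in sequentially. max 3 (4 / sqrt (\<kappa> / 2)) < R ^ M"
    using Rinf unfolding filterlim_at_top_dense by (rule spec)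
  have 3: "\<forall>\<^sub>F M :: nat in sequentially. 2 * pi / real M < \<theta>"
  proof -
    have "(\<lambda>M. 2 * pi / real M) \<longlonglongrightarrow> 0" by real_asymp
    then show ?thesis using assms(7) by (rule order_tendstoD)
  qed
  define b where "b = ln (1 / v)"
  have b: "0 < b" using assms by (simp add: b_def)
  have 4: "\<forall>\<^sub>F M :: nat in sequentially. 16 * (1 + ln 5 + 2 * b * real M) / (\<kappa> * R ^ M) < \<epsilon>"
  proof -
    have "(\<lambda>M. 16 * (1 + ln 5 + 2 * b * real M) / (\<kappa> * R ^ M)) \<longlonglongrightarrow> 0"
      using R assms b by real_asymp
    then show ?thesis using assms(6) by (rule order_tendstoD)
  qed
  have p2: "filterlim (\<lambda>N. 2 ^ N :: nat) sequentially sequentially"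
    by (rule filterlim_subseq) (simp add: strict_mono_def)
  have "\<forall>\<^sub>F N in sequentially. (r ^ (2 ^ N) < 1 / 2 \<and> max 3 (4 / sqrt (\<kappa> / 2)) < R ^ (2 ^ N) \<and> 2 * pi / real (2 ^ N) < \<theta> \<and>
      16 * (1 + ln 5 + 2 * b * real (2 ^ N)) / (\<kappa> * R ^ (2 ^ N)) < \<epsilon>) \<and> 0 < N"
    using eventually_compose_filterlim[OF eventually_conj[OF 1 eventually_conj[OF 2 eventually_conj[OF 3 4]]] p2]
    by (rule eventually_conj[OF _ eventually_gt_at_top])
  then obtain N where N: "r ^ (2 ^ N) < 1 / 2" "max 3 (4 / sqrt (\<kappa> / 2)) < R ^ (2 ^ N)" "2 * pi / real (2 ^ N) < \<theta>"
      "16 * (1 + ln 5 + 2 * b * real (2 ^ N)) / (\<kappa> * R ^ (2 ^ N)) < \<epsilon>" "0 < N"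
    by (metis (mono_tags, lifting) eventually_happens trivial_limit_sequentially)
  define x where "x = v ^ (2 ^ N)"
  have x: "0 < x" "x \<le> 1" using assms by (auto simp: x_def power_le_one)
  then have x2: "1 \<le> 1 / x\<^sup>2" using power_le_one[of x 2] by simp
  define n where "n = nat \<lceil>4 / x\<^sup>2\<rceil>"
  have n: "0 < n" "real n \<le> 5 / x\<^sup>2"
  proof -
    have "real n \<le> 4 / x\<^sup>2 + 1" using x2 by (simp add: n_def)
    then show "real n \<le> 5 / x\<^sup>2" using x2 by (simp add: field_simps)
    show "0 < n" using x by (simp add: n_def)
  qed
  have "harm n \<le> 1 + ln (real n)" by (rule harm_le_one_plus_ln[OF n(1)])
  also have "ln (real n) \<le> ln (5 / x\<^sup>2)" using n x by (subst ln_le_cancel_iff) auto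
  also have "\<dots> = ln 5 + 2 * b * real (2 ^ N)"
    using x assms by (simp add: ln_div ln_realpow x_def b_def)
  finally have "16 * harm n / (\<kappa> * R ^ (2 ^ N)) \<le> 16 * (1 + ln 5 + 2 * b * real (2 ^ N)) / (\<kappa> * R ^ (2 ^ N))"
    using R assms by (intro divide_right_mono) auto
  with N have "16 * harm n / (\<kappa> * R ^ (2 ^ N)) < \<epsilon>" by linarith
  moreover have "4 \<le> sqrt (\<kappa> / 2) * R ^ (2 ^ N)" using N(2) assms by (simp add: field_simps)
  ultimately show thesis using that[of N] N by (simp add: R_def n_def x_def)
qed

text \<open>The outcomes allowed for a block \<open>l\<close> entered at \<open>v\<close>. Escape is
  permitted only from outside the half disc, so a point that starts in the half disc and always
  takes good steps is found there at every block end. A nonescaping point must take the second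
  alternative, which supplies the line field estimate.\<close>

definition good_step :: "real \<Rightarrow> complex poly list \<Rightarrow> complex \<Rightarrow> bool" where
  "good_step \<epsilon> l v \<longleftrightarrow> (1 / 2 \<le> cmod v \<and> 3 < cmod (fold poly l v)) \<or>
     (cmod (fold poly l v) < 1 / 2 \<and> cmod (pullback (fold poly l) radial v - radial v) \<le> \<epsilon>)"

lemma good_step_squares:
  assumes "l = replicate N [:0, 0, 1:]" "0 < \<epsilon>" "v \<noteq> 0" "cmod v < r" "r ^ (2 ^ N) < 1 / 2"
  shows "good_step \<epsilon> l v"
proof -
  have F: "fold poly l = (\<lambda>z. z ^ (2 ^ N))" unfolding assms(1) by (rule ext) (rule fold_squares)
  have "cmod v ^ (2 ^ N) \<le> r ^ (2 ^ N)" using assms by (intro power_mono) auto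
  then show ?thesis using assms(2-) by (simp add: good_step_def F pullback_power_radial norm_power)
qed

lemma field_differentiable_fold_poly: "(\<lambda>z::complex. fold poly l z) field_differentiable at z"
  using holomorphic_on_imp_differentiable_at[OF holomorphic_fold_poly[of l UNIV]] by simp

text \<open>The squarings preserve the radial field exactly, so the whole error is that of the slit
  part at w = v^(2^N). The bound 1/8 keeps 4 q within the 1/2 required for comparing line fields,
  and \<epsilon>/16 makes the resulting 4 * 4 q at most \<epsilon>.\<close>

lemma good_step_slit:
  assumes l: "l = replicate N [:0, 0, 1:] @ slit_block a n" and a: "cmod a = 1"
    and \<epsilon>: "0 < \<epsilon>" and v: "v \<noteq> 0" "cmod v < r" "0 < r"
    and \<kappa>: "0 < \<kappa>" "\<kappa> \<le> 1" "Re (a * v ^ (2 ^ N)) \<le> (1 - \<kappa>) * cmod (v ^ (2 ^ N))"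
    and L: "4 \<le> sqrt (\<kappa> / 2) * (1 / r) ^ (2 ^ N)"
    and q: "16 * harm n / (\<kappa> * (1 / r) ^ (2 ^ N)) < min (1 / 8) (\<epsilon> / 16)"
  shows "good_step \<epsilon> l v"
proof -
  define w where "w = v ^ (2 ^ N)"
  define F where "F = fold poly (slit_block a n)"
  define q' where "q' = 16 * harm n / (\<kappa> * (1 / r) ^ (2 ^ N))"
  have w: "w \<noteq> 0" "cmod w \<le> 1 / (1 / r) ^ (2 ^ N)"
    using v power_mono[of "cmod v" r "2 ^ N"] by (auto simp: w_def norm_power power_divide)
  obtain F' where F': "(F has_field_derivative F') (at w)" "F w \<noteq> 0" "cmod (F w) < 1 / 2" "cmod (w * F' / F w - 1) \<le> 4 * q'"
    using slit_block_near_identity[OF a w \<kappa>(1,2) _ L _ q'_def] \<kappa>(3) q v(3) unfolding F_def w_def q'_def by auto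
  have "cmod (pullback F radial w - radial w) \<le> 4 * (4 * q')"
    by (rule pullback_radial_near[OF F'(1) w(1) F'(2,4)]) (use q in \<open>simp add: q'_def\<close>)
  also have "\<dots> \<le> \<epsilon>" using q by (simp add: q'_def)
  finally have 1: "cmod (pullback F radial w - radial w) \<le> \<epsilon>" .
  have G: "fold poly l = F \<circ> (\<lambda>z. z ^ (2 ^ N))" unfolding l F_def by (rule ext) (simp only: fold_append o_apply fold_squares)
  have d: "(\<lambda>z. z ^ (2 ^ N)) field_differentiable at v" by (intro derivative_intros)
  have "pullback (fold poly l) radial v = pullback (\<lambda>z. z ^ (2 ^ N)) (pullback F radial) v"
    unfolding G by (rule pullback_comp[OF d]) (simp add: F_def field_differentiable_fold_poly)
  moreover have "radial v = pullback (\<lambda>z. z ^ (2 ^ N)) radial v"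
    using pullback_power_radial[OF v(1), of "2 ^ N"] by simp
  ultimately have "cmod (pullback (fold poly l) radial v - radial v) \<le> cmod (pullback F radial w - radial w)"
    using norm_pullback_diff_le[of "\<lambda>z. z ^ (2 ^ N)" "pullback F radial" v radial] by (simp add: w_def)
  then show ?thesis using 1 F'(3) by (simp add: good_step_def G w_def)
qed

lemma good_step_outside:
  assumes l: "l = replicate N [:0, 0, 1:] @ l'" "set l' \<subseteq> quads"
    and v: "1 / r < cmod v" "0 < r" "r < 1" "3 < (1 / r) ^ (2 ^ N)"
  shows "good_step \<epsilon> l v"
proof -
  have "(1 / r) ^ (2 ^ N) \<le> cmod v ^ (2 ^ N)" using v by (intro power_mono) auto
  then have "3 < cmod (v ^ (2 ^ N))" using v(4) unfolding norm_power by linarith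
  then have "3 < cmod (fold poly l v)" unfolding l fold_append o_apply fold_squares by (rule fold_escape[OF l(2)])
  moreover have "1 \<le> cmod v" using v by (intro order_trans[OF _ less_imp_le[OF v(1)]]) auto
  ultimately show ?thesis by (simp add: good_step_def)
qed

lemma pigeonhole_measure:
  fixes T :: "nat \<Rightarrow> complex set"
  assumes "0 < K" "\<And>j. j < K \<Longrightarrow> T j \<in> lmeasurable" "\<And>j. j < K \<Longrightarrow> T j \<subseteq> U" "U \<in> lmeasurable"
    "disjoint_family_on T {..<K}"
  shows "\<exists>j<K. measure lebesgue (T j) \<le> measure lebesgue U / K"
proof (rule ccontr)
  assume "\<not> ?thesis"
  then have "(\<Sum>j<K. measure lebesgue U / K) < (\<Sum>j<K. measure lebesgue (T j))"
    using assms(1) by (intro sum_strict_mono) auto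
  also have "\<dots> = measure lebesgue (\<Union>j<K. T j)"
    using assms(2,5) by (intro measure_finite_Union[symmetric]) (auto simp: fmeasurableD fmeasurableD2 simp del: emeasure_completion)
  also have "\<dots> \<le> measure lebesgue U"
    using assms by (intro measure_mono_fmeasurable) (auto intro: fmeasurableD)
  finally show False using assms(1) by simp
qed

text \<open>The exceptional set consists of the preimage of a thin annulus, the zeros of the
  composition and, if a slit is cut, the preimage of one sector. All other points either escape
  under the squarings or are squeezed towards 0 off that sector, where the slit part is nearly the
  identity.\<close>

lemma exists_block:
  assumes l: "set l \<subseteq> quads" and B: "open B" "B \<noteq> {}" and \<epsilon>: "0 < \<epsilon>"
  shows "\<exists>l'. l' \<noteq> [] \<and> set l' \<subseteq> quads \<and> (\<exists>z\<in>B. 3 < cmod (fold poly (l @ l') z)) \<and>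
    (\<exists>S. S \<in> lmeasurable \<and> measure lebesgue S < \<epsilon> \<and>
      (\<forall>z. cmod (fold poly l z) \<le> 3 \<longrightarrow> z \<notin> S \<longrightarrow> good_step \<epsilon> l' (fold poly l z)))"
proof -
  define Q where "Q = (\<lambda>z::complex. fold poly l z)"
  have [measurable]: "Q \<in> borel_measurable borel" unfolding Q_def by (rule borel_measurable_fold_poly)
  define D where "D = {z. cmod (Q z) \<le> 3}"
  have D: "D \<in> lmeasurable" unfolding D_def
    by (rule fmeasurable_bounded_borel) (use bounded_vimage_fold[OF l] in \<open>auto simp: Q_def\<close>)
  have \<epsilon>2: "0 < \<epsilon> / 2" using \<epsilon> by simp
  obtain r where r: "1 / 2 < r" "r < 1" and A: "{z. r \<le> cmod (Q z) \<and> cmod (Q z) \<le> 1 / r} \<in> lmeasurable"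
    "measure lebesgue {z. r \<le> cmod (Q z) \<and> cmod (Q z) \<le> 1 / r} < \<epsilon> / 2"
    by (rule thin_annulus[OF l \<epsilon>2, folded Q_def])
  define U where "U = {z. r \<le> cmod (Q z) \<and> cmod (Q z) \<le> 1 / r} \<union> {z. Q z = 0}"
  have Z: "negligible {z. Q z = 0}" using negligible_vimage_fold[OF l negligible_sing, of 0] by (simp add: Q_def)
  have U: "U \<in> lmeasurable" "measure lebesgue U < \<epsilon> / 2"
  proof -
    show "U \<in> lmeasurable" unfolding U_def by (intro fmeasurable.Un A(1) negligible_imp_measurable Z)
    have "measure lebesgue U \<le> measure lebesgue {z. r \<le> cmod (Q z) \<and> cmod (Q z) \<le> 1 / r} + measure lebesgue {z. Q z = 0}"
      unfolding U_def by (rule measure_Un_le[OF fmeasurableD[OF A(1)] fmeasurableD[OF negligible_imp_measurable[OF Z]]])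
    then show "measure lebesgue U < \<epsilon> / 2" using A(2) negligible_imp_measure0[OF Z] by linarith
  qed
  have Uout: "Q z \<noteq> 0" "cmod (Q z) < r \<or> 1 / r < cmod (Q z)" if "z \<notin> U" for z
    using that by (auto simp: U_def)
  have QB: "open (Q ` B - sphere 0 1 - {0})" unfolding Q_def
    using open_fold_image[OF l B(1)] by (intro open_Diff) auto
  \<comment> \<open>A nonempty open image is not null, so it contains a point off the unit circle
    and different from 0. Being off the circle separates the two cases below; being nonzero gives
    the point on the slit a positive modulus.\<close>
  have "negligible (sphere 0 (1::real) \<union> {0::complex})" by (simp add: negligible_sphere)
  then have "\<not> Q ` B \<subseteq> sphere 0 1 \<union> {0}"
    using open_not_negligible[of "Q ` B"] open_fold_image[OF l B(1)] B(2) negligible_subset unfolding Q_def by blast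
  then obtain v0 where v0: "v0 \<in> Q ` B - sphere 0 1 - {0}" by blast
  then obtain \<delta> where \<delta>: "0 < \<delta>" "ball v0 \<delta> \<subseteq> Q ` B - sphere 0 1 - {0}" using QB open_contains_ball by blast
  show ?thesis
  proof (cases "1 < cmod v0")
    case True
    \<comment> \<open>Outside the unit circle squaring alone makes the chosen point escape, so this
      block has no slit.\<close>
    obtain z0 where z0: "z0 \<in> B" "Q z0 = v0" using v0 by auto
    obtain N where N: "r ^ (2 ^ N) < 1 / 2" "3 < (1 / r) ^ (2 ^ N)" "3 < cmod v0 ^ (2 ^ N)" "0 < N"
    proof -
      have R: "1 < 1 / r" using r by simp
      have p2: "filterlim (\<lambda>N. 2 ^ N :: nat) sequentially sequentially"
        by (rule filterlim_subseq) (simp add: strict_mono_def)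
      have 1: "\<forall>\<^sub>F M :: nat in sequentially. r ^ M < 1 / 2"
        using r by (intro order_tendstoD(2)[OF LIMSEQ_power_zero]) auto
      have gt: "\<forall>\<^sub>F M :: nat in sequentially. 3 < x ^ M" if "1 < x" for x :: real
      proof -
        have "filterlim (\<lambda>M. x ^ M) at_top sequentially" using that by real_asymp
        then show ?thesis unfolding filterlim_at_top_dense by (rule spec)
      qed
      have "\<forall>\<^sub>F N in sequentially. (r ^ (2 ^ N) < 1 / 2 \<and> 3 < (1 / r) ^ (2 ^ N) \<and> 3 < cmod v0 ^ (2 ^ N)) \<and> 0 < N"
        using eventually_compose_filterlim[OF eventually_conj[OF 1 eventually_conj[OF gt[OF R] gt[OF True]]] p2]
        by (rule eventually_conj[OF _ eventually_gt_at_top])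
      then show thesis using that by (metis (mono_tags, lifting) eventually_happens trivial_limit_sequentially)
    qed
    define l' where "l' = replicate N [:0, 0, 1:: complex:]"
    have "l' \<noteq> []" "set l' \<subseteq> quads" using N(4) square_quads by (auto simp: l'_def)
    moreover have "3 < cmod (fold poly (l @ l') z0)"
      using N(3) z0 by (simp only: l'_def fold_append o_apply fold_squares) (simp add: norm_power Q_def)
    moreover have "good_step \<epsilon> l' (fold poly l z)" if "z \<notin> U" for z
      using Uout[OF that] good_step_squares[OF l'_def \<epsilon> _ _ N(1), of "Q z"] good_step_outside[of l' N "[]" r "Q z"] r N(2)
      by (auto simp: l'_def Q_def)
    moreover have "measure lebesgue U < \<epsilon>" using U \<epsilon> by linarith
    ultimately show ?thesis using U z0 by blast
  next
    case False
    then have v1: "0 < cmod v0" "cmod v0 < 1" using v0 by auto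
    define m where "m = measure lebesgue D"
    \<comment> \<open>The number of sectors depends only on the area of \<open>D\<close> and on
      \<epsilon>. Hence \<kappa> is fixed before N, whose choice depends on it.\<close>
    obtain K :: nat where K: "m / (\<epsilon> / 4) < K" using reals_Archimedean2 by blast
    have m0: "0 \<le> m" by (simp add: m_def)
    have "0 \<le> m / (\<epsilon> / 4)" using m0 \<epsilon> by simp
    then have "0 < real K" using K by linarith
    then have K0: "0 < K" by simp
    have mK: "m / K < \<epsilon> / 2" using K K0 \<epsilon> m0 by (simp add: field_simps)
    obtain \<kappa> where \<kappa>: "0 < \<kappa>" "\<kappa> \<le> 1" and disj:
      "\<And>i j u. i < j \<Longrightarrow> j < K \<Longrightarrow> (1 - \<kappa>) * cmod u < Re (cis (2 * pi / K) ^ i * u) \<Longrightarrow>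
       (1 - \<kappa>) * cmod u < Re (cis (2 * pi / K) ^ j * u) \<Longrightarrow> False"
      using disjoint_sectors[of K] by metis
    define \<omega> where "\<omega> = cis (2 * pi / K)"
    have "isCont (\<lambda>t. v0 * cis t) 0" by (simp add: cis_conv_exp)
    then obtain \<theta> where \<theta>: "0 < \<theta>" "\<And>t. \<bar>t\<bar> < \<theta> \<Longrightarrow> v0 * cis t \<in> ball v0 \<delta>"
      using \<delta>(1) unfolding continuous_at_eps_delta by (auto simp: dist_norm norm_minus_commute)
    obtain N where N: "0 < N" "r ^ (2 ^ N) < 1 / 2" "3 < (1 / r) ^ (2 ^ N)" "2 * pi / 2 ^ N < \<theta>"
        "4 \<le> sqrt (\<kappa> / 2) * (1 / r) ^ (2 ^ N)"
        "16 * harm (nat \<lceil>4 / (cmod v0 ^ (2 ^ N))\<^sup>2\<rceil>) / (\<kappa> * (1 / r) ^ (2 ^ N)) < min (1 / 8) (\<epsilon> / 16)"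
      using good_scale[OF r v1 \<kappa>(1) _ \<theta>(1), of "min (1 / 8) (\<epsilon> / 16)"] \<epsilon> by auto
    define M :: nat where "M = 2 ^ N"
    \<comment> \<open>The sectors around the K rotated slits have disjoint preimages, so one of them has small area.
      That direction is available because the M-th powers of v0 * cis t turn once around 0 for t up to 2 * pi / M.\<close>
    define T where "T = (\<lambda>j. {z. cmod (Q z) \<le> 3 \<and> (1 - \<kappa>) * cmod (Q z ^ M) < Re (\<omega> ^ j * Q z ^ M)})"
    have TD: "T j \<subseteq> D" for j by (auto simp: T_def D_def)
    have D3: "D \<subseteq> cball 0 3" using bounded_vimage_fold[OF l] by (simp add: D_def Q_def)
    have Tm: "T j \<in> lmeasurable" for j
      by (rule fmeasurable_bounded_borel[OF _ order_trans[OF TD D3]]) (simp add: T_def)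
    have "disjoint_family_on T {..<K}"
      unfolding disjoint_family_on_def
    proof (intro ballI impI)
      have lt: "T i \<inter> T j = {}" if "i < j" "j < K" for i j
        using disj[OF that] unfolding T_def \<omega>_def by blast
      fix i j assume "i \<in> {..<K}" "j \<in> {..<K}" "i \<noteq> j"
      then show "T i \<inter> T j = {}"
        using lt[of i j] lt[of j i] by (metis Int_commute lessThan_iff linorder_neqE_nat)
    qed
    then obtain j where j: "j < K" "measure lebesgue (T j) \<le> m / K"
      using pigeonhole_measure[of K T D, OF K0 Tm TD D] by (auto simp: m_def)
    define a where "a = \<omega> ^ j"
    have a: "cmod a = 1" by (simp add: a_def \<omega>_def norm_power)
    define t where "t = (2 * pi - Arg2pi (a * v0 ^ M)) / M"
    have M0: "0 < real M" by (simp add: M_def)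
    have t: "0 < t" "t \<le> 2 * pi / M"
      using Arg2pi_lt_2pi[of "a * v0 ^ M"] Arg2pi_ge_0[of "a * v0 ^ M"] M0
      by (auto simp: t_def intro!: divide_right_mono)
    have "v0 * cis t \<in> ball v0 \<delta>" using \<theta>(2)[of t] t N(4) by (simp add: M_def)
    then have "v0 * cis t \<in> Q ` B" using \<delta>(2) by blast
    then obtain z0 where z0: "z0 \<in> B" "Q z0 = v0 * cis t" by (metis imageE)
    define x where "x = cmod v0 ^ M"
    have x0: "0 < x" using v1 by (simp add: x_def)
    have w0: "a * (v0 * cis t) ^ M = of_real x"
    proof -
      have "a * v0 ^ M = of_real (cmod (a * v0 ^ M)) * exp (\<i> * of_real (Arg2pi (a * v0 ^ M)))"
        by (rule Arg2pi_eq)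
      also have "cmod (a * v0 ^ M) = x" using a by (simp add: norm_mult norm_power x_def)
      finally have e: "a * v0 ^ M = of_real x * cis (Arg2pi (a * v0 ^ M))" by (simp add: cis_conv_exp)
      have "cis t ^ M = cis (2 * pi - Arg2pi (a * v0 ^ M))"
        using M0 by (simp add: Complex.DeMoivre t_def)
      then have "a * (v0 * cis t) ^ M = a * v0 ^ M * cis (2 * pi - Arg2pi (a * v0 ^ M))"
        by (simp add: power_mult_distrib)
      also have "\<dots> = of_real x * (cis (Arg2pi (a * v0 ^ M)) * cis (2 * pi - Arg2pi (a * v0 ^ M)))"
        by (subst (1) e) simp
      finally show ?thesis unfolding cis_mult by (simp add: cis_2pi)
    qed
    define n where "n = nat \<lceil>4 / x\<^sup>2\<rceil>"
    define l' where "l' = replicate N [:0, 0, 1:] @ slit_block a n"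
    have l': "l' \<noteq> []" "set l' \<subseteq> quads" using N(1) square_quads slit_block_quads[OF a] by (auto simp: l'_def)
    have "4 / x\<^sup>2 \<le> real n" by (simp add: n_def)
    then have "3 < cmod (fold poly (slit_block a n) ((v0 * cis t) ^ M))"
      by (rule slit_block_escape[OF a w0 x0])
    then have esc: "3 < cmod (fold poly (l @ l') z0)"
      using z0(2) by (simp only: l'_def fold_append o_apply fold_squares Q_def M_def)
    have good: "good_step \<epsilon> l' (Q z)" if "cmod (Q z) \<le> 3" "z \<notin> U \<union> T j" for z
    proof (cases "1 / r < cmod (Q z)")
      case True then show ?thesis
        using good_step_outside[OF l'_def slit_block_quads[OF a]] r N(3) by auto
    next
      case False
      have "Re (a * Q z ^ M) \<le> (1 - \<kappa>) * cmod (Q z ^ M)"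
        using that by (auto simp: T_def a_def not_less)
      then show ?thesis
        using good_step_slit[OF l'_def a \<epsilon> _ _ _ \<kappa> _ N(5)] N(6) Uout[of z] that False r
        by (auto simp: M_def n_def x_def)
    qed
    have "measure lebesgue (U \<union> T j) \<le> measure lebesgue U + measure lebesgue (T j)"
      using U Tm by (intro measure_Un_le) (auto intro: fmeasurableD)
    then have "measure lebesgue (U \<union> T j) < \<epsilon>" using U(2) j(2) mK by linarith
    moreover have "U \<union> T j \<in> lmeasurable" using U Tm by (intro fmeasurable.Un)
    ultimately show ?thesis using l' esc good z0(1) unfolding Q_def by blast
  qed
qed

section \<open>Surjectivity and critical points of the compositions\<close>

text \<open>Every point at time m is thus the image of a point at time 0, where the escaping points
  and the regularity of the line fields are under control. Each single map is inverted by completing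
  the square.\<close>

lemma surj_fold_quads:
  assumes "set l \<subseteq> quads"
  shows "surj (\<lambda>z::complex. fold poly l z)"
  using assms
proof (induction l)
  case (Cons p l)
  then obtain a b where p: "p = [:0, b, a:]" and "cmod a = 1"
    unfolding quads_def by force
  then have a: "a \<noteq> 0" by auto
  define h where "h = b / (2 * a)"
  have "poly p (csqrt (w / a + h\<^sup>2) - h) = w" for w
  proof -
    have "poly p (y - h) = a * (y\<^sup>2 - h\<^sup>2)" for y
      using a by (simp add: p h_def power2_eq_square field_simps)
    then show ?thesis using a by simp
  qed
  then have "surj (poly p)" by (rule surjI)
  moreover have "surj (\<lambda>z::complex. fold poly l z)" using Cons by simp
  ultimately have "surj ((\<lambda>z. fold poly l z) \<circ> poly p)" by (rule comp_surj)
  then show ?case by (simp add: o_def)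
qed simp

text \<open>By the chain rule a new critical point lies over the critical point -b / (2 a) of the
  last map, and a point has a null preimage. Critical points are discarded because the pullback
  factor there is 0 / 0, with value 0.\<close>

lemma negligible_deriv_fold_zero:
  assumes "set l \<subseteq> quads"
  shows "negligible {z::complex. deriv (fold poly l) z = 0}"
  using assms
proof (induction l rule: rev_induct)
  case (snoc p l)
  then obtain a b where p: "p = [:0, b, a:]" and "cmod a = 1"
    unfolding quads_def by force
  then have a: "a \<noteq> 0" by auto
  have "deriv (fold poly (l @ [p])) z = (b + 2 * a * fold poly l z) * deriv (fold poly l) z" for z
  proof -
    have dp: "(poly p has_field_derivative b + 2 * a * u) (at u)" for u
      unfolding p by (rule poly_DERIV[THEN DERIV_cong]) (simp add: pderiv_pCons)
    have "(poly p \<circ> fold poly l has_field_derivative (b + 2 * a * fold poly l z) * deriv (fold poly l) z) (at z)"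
      by (rule DERIV_chain[OF dp]) (rule field_differentiable_fold_poly[THEN field_differentiable_derivI])
    then show ?thesis by (simp add: DERIV_imp_deriv o_def)
  qed
  then have "{z. deriv (fold poly (l @ [p])) z = 0}
      \<subseteq> {z. fold poly l z \<in> {- b / (2 * a)}} \<union> {z. deriv (fold poly l) z = 0}"
  proof (intro subsetI UnCI)
    fix z assume *: "\<And>z. deriv (fold poly (l @ [p])) z = (b + 2 * a * fold poly l z) * deriv (fold poly l) z"
      "z \<in> {z. deriv (fold poly (l @ [p])) z = 0}" "z \<notin> {z. deriv (fold poly l) z = 0}"
    then have "(b + 2 * a * fold poly l z) * deriv (fold poly l) z = 0" "deriv (fold poly l) z \<noteq> 0" by simp_all
    then have "b + 2 * a * fold poly l z = 0" by simp
    then have e: "2 * a * fold poly l z = - b" by (simp only: add_eq_0_iff)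
    have "fold poly l z = 2 * a * fold poly l z / (2 * a)" using a by simp
    also have "\<dots> = - b / (2 * a)" by (simp only: e)
    finally have "fold poly l z = - b / (2 * a)" .
    then show "z \<in> {z. fold poly l z \<in> {- b / (2 * a)}}" by simp
  qed
  moreover have "negligible ({z. fold poly l z \<in> {- b / (2 * a)}} \<union> {z. deriv (fold poly l) z = 0})"
    using snoc by (intro negligible_Un negligible_vimage_fold negligible_sing) auto
  ultimately show ?case using negligible_subset by blast
qed simp

lemma convergent_of_geometric_steps:
  fixes T :: "nat \<Rightarrow> complex"
  assumes "\<And>j. j0 \<le> j \<Longrightarrow> cmod (T (Suc j) - T j) \<le> e j" "summable e"
  shows "convergent T"
proof -
  have "summable (\<lambda>j. T (Suc j) - T j)"
    by (rule summable_comparison_test'[OF assms(2)]) (rule assms(1))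
  then have "convergent (\<lambda>n. \<Sum>j<n. T (Suc j) - T j)" by (rule summable_iff_convergent[THEN iffD1])
  then have "convergent (\<lambda>n. T n - T 0)" by (simp add: sum_lessThan_telescope)
  from convergent_add[OF this convergent_const[of "T 0"]] show ?thesis by simp
qed

section \<open>Concatenating the blocks\<close>

lemma countable_open_test_sets:
  obtains B :: "nat \<Rightarrow> complex set" where "\<And>k. open (B k)" "\<And>k. B k \<noteq> {}"
    "\<And>V x. open V \<Longrightarrow> x \<in> V \<Longrightarrow> \<exists>k. B k \<subseteq> V"
proof -
  obtain BB :: "complex set set" where BB: "countable BB" "topological_basis BB"
    using ex_countable_basis by blast
  obtain X0 where "X0 \<in> BB" "0 \<in> X0"
    by (rule topological_basisE[OF BB(2) open_UNIV UNIV_I])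
  then have ne: "BB - {{}} \<noteq> {}" by auto
  define B where "B = from_nat_into (BB - {{}})"
  have B: "B k \<in> BB - {{}}" for k unfolding B_def using ne by (rule from_nat_into)
  have r: "range B = BB - {{}}" unfolding B_def using ne BB(1) by (intro range_from_nat_into) auto
  show thesis
  proof (rule that)
    show "open (B k)" "B k \<noteq> {}" for k using B[of k] topological_basis_open[OF BB(2)] by auto
    fix V x assume "open V" "(x :: complex) \<in> V"
    then obtain X where X: "X \<in> BB" "x \<in> X" "X \<subseteq> V" by (rule topological_basisE[OF BB(2)])
    then have "X \<in> range B" using r by auto
    then show "\<exists>k. B k \<subseteq> V" using X by auto
  qed
qed

text \<open>Block j has to make some point of \<open>B j\<close> escape, and \<open>e j\<close> is
  its allowance both for lost area and for the line field error. The recursion runs over the lists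
  of all maps chosen so far, because the choice of a block depends on the whole composition before
  it.\<close>

lemma exists_block_sequence:
  fixes e :: "nat \<Rightarrow> real" and B :: "nat \<Rightarrow> complex set"
  assumes "\<And>j. 0 < e j" "\<And>k. open (B k)" "\<And>k. B k \<noteq> {}"
  obtains P n l S where
    "\<And>i. P (Suc i) \<in> quads" "strict_mono n" "n 0 = 0"
    "\<And>j z. Qcomp P 0 (n (Suc j)) z = fold poly (l j) (Qcomp P 0 (n j) z)"
    "\<And>j. \<exists>z\<in>B j. 3 < cmod (Qcomp P 0 (n (Suc j)) z)"
    "\<And>j. S j \<in> lmeasurable" "\<And>j. measure lebesgue (S j) < e j"
    "\<And>j z. cmod (Qcomp P 0 (n j) z) \<le> 3 \<Longrightarrow> z \<notin> S j \<Longrightarrow> good_step (e j) (l j) (Qcomp P 0 (n j) z)"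
proof -
  have "\<exists>L. \<forall>j. set (L j) \<subseteq> quads \<and> (j = 0 \<longrightarrow> L j = []) \<and>
    (\<exists>l'. L (Suc j) = L j @ l' \<and> l' \<noteq> [] \<and> (\<exists>z\<in>B j. 3 < cmod (fold poly (L j @ l') z)) \<and>
     (\<exists>S. S \<in> lmeasurable \<and> measure lebesgue S < e j \<and>
      (\<forall>z. cmod (fold poly (L j) z) \<le> 3 \<longrightarrow> z \<notin> S \<longrightarrow> good_step (e j) l' (fold poly (L j) z))))"
    (is "\<exists>L. \<forall>j. ?X j L")
  proof -
    have "\<exists>L. \<forall>j. (set (L j) \<subseteq> quads \<and> (j = 0 \<longrightarrow> L j = [])) \<and>
     (\<exists>l'. L (Suc j) = L j @ l' \<and> l' \<noteq> [] \<and> (\<exists>z\<in>B j. 3 < cmod (fold poly (L j @ l') z)) \<and>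
     (\<exists>S. S \<in> lmeasurable \<and> measure lebesgue S < e j \<and>
      (\<forall>z. cmod (fold poly (L j) z) \<le> 3 \<longrightarrow> z \<notin> S \<longrightarrow> good_step (e j) l' (fold poly (L j) z))))"
    proof (rule dependent_nat_choice)
      show "\<exists>x. set x \<subseteq> quads \<and> ((0::nat) = 0 \<longrightarrow> x = [])" by simp
      fix x and j :: nat assume "set x \<subseteq> quads \<and> (j = 0 \<longrightarrow> x = [])"
      then have x: "set x \<subseteq> quads" by simp
      obtain l' where l': "l' \<noteq> []" "set l' \<subseteq> quads" "\<exists>z\<in>B j. 3 < cmod (fold poly (x @ l') z)"
        "\<exists>S. S \<in> lmeasurable \<and> measure lebesgue S < e j \<and>
          (\<forall>z. cmod (fold poly x z) \<le> 3 \<longrightarrow> z \<notin> S \<longrightarrow> good_step (e j) l' (fold poly x z))"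
        using exists_block[OF x assms(2)[of j] assms(3)[of j] assms(1)[of j]] by blast
      show "\<exists>y. (set y \<subseteq> quads \<and> (Suc j = 0 \<longrightarrow> y = [])) \<and> (\<exists>l'. y = x @ l' \<and> l' \<noteq> [] \<and>
          (\<exists>z\<in>B j. 3 < cmod (fold poly (x @ l') z)) \<and> (\<exists>S. S \<in> lmeasurable \<and> measure lebesgue S < e j \<and>
          (\<forall>z. cmod (fold poly x z) \<le> 3 \<longrightarrow> z \<notin> S \<longrightarrow> good_step (e j) l' (fold poly x z))))"
        by (rule exI[of _ "x @ l'"]) (use x l' in auto)
    qed
    then show ?thesis by (simp only: conj_assoc)
  qed
  then obtain L where "\<forall>j. ?X j L" by blast
  then have L: "\<And>j. set (L j) \<subseteq> quads" "L 0 = []" and "\<forall>j. \<exists>l' S. L (Suc j) = L j @ l' \<and> l' \<noteq> [] \<and>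
      (\<exists>z\<in>B j. 3 < cmod (fold poly (L j @ l') z)) \<and> S \<in> lmeasurable \<and> measure lebesgue S < e j \<and>
      (\<forall>z. cmod (fold poly (L j) z) \<le> 3 \<longrightarrow> z \<notin> S \<longrightarrow> good_step (e j) l' (fold poly (L j) z))"
    by blast+
  from choice[OF this(3)] obtain l where "\<forall>j. \<exists>S. L (Suc j) = L j @ l j \<and> l j \<noteq> [] \<and>
      (\<exists>z\<in>B j. 3 < cmod (fold poly (L j @ l j) z)) \<and> S \<in> lmeasurable \<and> measure lebesgue S < e j \<and>
      (\<forall>z. cmod (fold poly (L j) z) \<le> 3 \<longrightarrow> z \<notin> S \<longrightarrow> good_step (e j) (l j) (fold poly (L j) z))" ..
  from choice[OF this] obtain S where lS: "\<And>j. L (Suc j) = L j @ l j" "\<And>j. l j \<noteq> []"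
      "\<And>j. \<exists>z\<in>B j. 3 < cmod (fold poly (L j @ l j) z)" "\<And>j. S j \<in> lmeasurable" "\<And>j. measure lebesgue (S j) < e j"
      "\<And>j z. cmod (fold poly (L j) z) \<le> 3 \<Longrightarrow> z \<notin> S j \<Longrightarrow> good_step (e j) (l j) (fold poly (L j) z)"
    by blast
  define n where "n = (\<lambda>j. length (L j))"
  have n: "strict_mono n" unfolding strict_mono_Suc_iff n_def by (simp add: lS)
  \<comment> \<open>No block is empty, so \<open>L m\<close> has at least m entries, and since the
    lists extend each other every sufficiently long one gives the same entry. The shift by one
    reflects that the sequence of polynomials starts at index 1.\<close>
  define P where "P = (\<lambda>m. L m ! (m - 1))"
  have nth: "L (j + d) ! i = L j ! i" if "i < n j" for i j d
  proof (induction d)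
    case (Suc d)
    have "i < n (j + d)" using that strict_mono_less_eq[OF n, of j "j + d"] by linarith
    then show ?case using Suc by (simp add: lS nth_append n_def)
  qed simp
  have nth': "L k ! i = L j ! i" if "i < n j" "i < n k" for i j k
    using nth[of i j "k - j"] nth[of i k "j - k"] that by (cases "j \<le> k") auto
  have ge: "j \<le> n j" for j using n by (rule strict_mono_imp_increasing)
  have Pi: "P (Suc i) = L j ! i" if "i < n j" for i j
    unfolding P_def using nth'[of i j "Suc i"] that ge[of "Suc i"] by simp
  have PL: "map P [Suc 0..<Suc (n j)] = L j" for j
  proof (rule nth_equalityI)
    fix i assume "i < length (map P [Suc 0..<Suc (n j)])"
    then show "map P [Suc 0..<Suc (n j)] ! i = L j ! i" using Pi[of i j] by (simp del: upt_Suc)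
  qed (simp add: n_def del: upt_Suc)
  have Q: "Qcomp P 0 (n j) z = fold poly (L j) z" for j z
    using Qcomp_eq_fold[of 0 "n j" P] PL by (simp del: upt_Suc)
  show thesis
  proof (rule that)
    show "P (Suc i) \<in> quads" for i
    proof -
      have "i < n (Suc i)" using ge[of "Suc i"] by simp
      then have "P (Suc i) \<in> set (L (Suc i))" using Pi[of i "Suc i"] by (simp add: n_def)
      then show ?thesis using L by blast
    qed
    show "strict_mono n" by fact
    show "n 0 = 0" by (simp add: n_def L)
    show "Qcomp P 0 (n (Suc j)) z = fold poly (l j) (Qcomp P 0 (n j) z)" for j z
      by (simp only: Q lS fold_append o_apply)
    show "\<exists>z\<in>B j. 3 < cmod (Qcomp P 0 (n (Suc j)) z)" for j unfolding Q lS(1) by (rule lS)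
    show "S j \<in> lmeasurable" "measure lebesgue (S j) < e j" for j by (fact lS)+
    show "good_step (e j) (l j) (Qcomp P 0 (n j) z)" if "cmod (Qcomp P 0 (n j) z) \<le> 3" "z \<notin> S j" for j z
      using lS(6)[of j z] that unfolding Q by blast
  qed
qed

section \<open>The invariant sequence of line fields\<close>

lemma norm_pullback_unimodular:
  assumes "cmod (\<mu> (f z)) = 1" "deriv f z \<noteq> 0"
  shows "cmod (pullback f \<mu> z) = 1"
  using assms by (simp add: pullback_def norm_mult norm_divide)

lemma borel_measurable_pullback_radial:
  assumes "f holomorphic_on UNIV"
  shows "pullback f radial \<in> borel_measurable borel"
proof -
  have [measurable]: "f \<in> borel_measurable borel" "deriv f \<in> borel_measurable borel"
    using assms holomorphic_deriv[OF assms]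
    by (auto intro!: borel_measurable_continuous_onI holomorphic_on_imp_continuous_on)
  have [measurable]: "cnj \<in> borel_measurable borel"
    by (intro borel_measurable_continuous_onI continuous_intros)
  show ?thesis unfolding pullback_def radial_def by measurable
qed

lemma negligible_imp_AE:
  assumes "negligible N" "\<And>z. z \<notin> N \<Longrightarrow> R z"
  shows "AE z in lebesgue. R z"
  using assms by (intro AE_I'[of N]) (auto simp: negligible_iff_null_sets)

theorem theorem1p2:
  shows "\<exists>(P :: nat \<Rightarrow> complex poly) d K M.
     bounded_seq_poly P d K M \<and> (\<forall>m\<ge>1. degree (P m) = 2) \<and>
     (\<forall>m. julia_C P m \<in> sets lebesgue \<and> 0 < emeasure lebesgue (julia_C P m)) \<and>
     (\<exists>\<mu> :: nat \<Rightarrow> complex \<Rightarrow> complex.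
        (\<forall>m n. m < n \<longrightarrow> (AE z in lebesgue. pullback (Qcomp P m n) (\<mu> n) z = \<mu> m z)) \<and>
        (\<forall>m. \<exists>E. line_field_on E (\<mu> m) \<and> E \<subseteq> julia_C P m \<and>
               countable (julia P m - Some ` E)))"
proof -
  obtain B :: "nat \<Rightarrow> complex set" where B: "\<And>k. open (B k)" "\<And>k. B k \<noteq> {}"
    "\<And>V x. open V \<Longrightarrow> x \<in> V \<Longrightarrow> \<exists>k. B k \<subseteq> V"
    using countable_open_test_sets by metis
  define c where "c = measure lebesgue (ball (0::complex) (1/2))"
  have c: "0 < c" unfolding c_def by (simp add: content_ball_pos)
  \<comment> \<open>The allowances sum to c / 2, half the area of the disc of radius 1/2, so the
    other half remains for the nonescaping set.\<close>
  define e where "e = (\<lambda>j. c / 4 * (1 / 2) ^ j)"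
  have e: "0 < e j" for j using c by (simp add: e_def)
  have e_sums: "e sums (c / 2)"
    unfolding e_def using sums_mult[OF geometric_sums[of "1 / 2 :: real"], of "c / 4"] by simp
  then have e_summable: "summable e" by (rule sums_summable)
  obtain P n l S where P: "\<And>i. P (Suc i) \<in> quads" and n: "strict_mono n" "n 0 = 0"
    and step: "\<And>j z. Qcomp P 0 (n (Suc j)) z = fold poly (l j) (Qcomp P 0 (n j) z)"
    and esc: "\<And>j. \<exists>z\<in>B j. 3 < cmod (Qcomp P 0 (n (Suc j)) z)"
    and S: "\<And>j. S j \<in> lmeasurable" "\<And>j. measure lebesgue (S j) < e j"
    and good: "\<And>j z. cmod (Qcomp P 0 (n j) z) \<le> 3 \<Longrightarrow> z \<notin> S j \<Longrightarrow> good_step (e j) (l j) (Qcomp P 0 (n j) z)"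
    using exists_block_sequence[of e B, OF e B(1,2)] by metis
  have ge: "j \<le> n j" for j using n(1) by (rule strict_mono_imp_increasing)
  define K where "K = nonescaping P"
  have fold: "\<exists>ps. set ps \<subseteq> quads \<and> Qcomp P m k = fold poly ps" for m k
  proof (cases "m \<le> k")
    case True then show ?thesis using Qcomp_eq_fold[OF True] set_map_P[where P = P, OF P] by metis
  next
    case False then show ?thesis by (intro exI[of _ "[]"]) (simp add: id_def)
  qed
  have null_vimage: "negligible {z. Qcomp P m k z \<in> N}" if "negligible N" for m k N
    using fold[of m k] negligible_vimage_fold that by metis
  have null_crit: "negligible {z. deriv (Qcomp P m k) z = 0}" for m k
    using fold[of m k] negligible_deriv_fold_zero by metis
  have surjQ: "surj (Qcomp P m k)" for m k
    using fold[of m k] surj_fold_quads by metis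
  have fdiff: "Qcomp P m k field_differentiable at z" for m k z
    using holomorphic_on_imp_differentiable_at[OF holomorphic_Qcomp[of P m k UNIV]] by simp
  have in_K: "Qcomp P m k z \<in> K k \<longleftrightarrow> z \<in> K m" if "m \<le> k" for m k z
    unfolding K_def using Qcomp_in_nonescaping_iff[where P = P, OF P that] .

  \<comment> \<open>The blocks are aimed at open sets of time 0. An open set at time m is reached by
    pulling it back with the surjective composition up to m and pushing the escaping point
    forward.\<close>
  have dense: "\<exists>z'\<in>V. z' \<notin> K m" if V: "open V" "z \<in> V" for V z m
  proof -
    obtain w where w: "Qcomp P 0 m w = z" using surjQ by (metis surjD)
    have "open (Qcomp P 0 m -` V)" using V(1) by (intro continuous_open_vimage isCont_Qcomp)
    moreover have "w \<in> Qcomp P 0 m -` V" using w V(2) by simp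
    ultimately obtain k where k: "B k \<subseteq> Qcomp P 0 m -` V" using B(3) by blast
    obtain z1 where z1: "z1 \<in> B k" "3 < cmod (Qcomp P 0 (n (Suc k)) z1)" using esc by blast
    then have "z1 \<notin> K 0" by (auto simp: K_def nonescaping_def not_le)
    then have "Qcomp P 0 m z1 \<notin> K m" using in_K[of 0 m z1] by simp
    then show ?thesis using z1 k by blast
  qed
  have julia: "julia P m = Some ` K m" for m
  proof
    show "julia P m \<subseteq> Some ` K m" unfolding K_def by (rule julia_subset[where P = P, OF P])
    show "Some ` K m \<subseteq> julia P m"
      using nonescaping_in_julia[where P = P, OF P] dense unfolding K_def by blast
  qed
  then have julia_C: "julia_C P m = K m" for m by (auto simp: julia_C_def)
  have K_borel: "K m \<in> sets borel" for m unfolding K_def by (intro borel_closed closed_nonescaping)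
  have K_leb: "K m \<in> sets lebesgue" for m using K_borel by (metis sets_completionI_sets sets_lborel)

  \<comment> \<open>A point of the half disc outside all \<open>S j\<close> is in the half disc at
    every block end. An escape at any time k would still be visible at the block end
    \<open>n k\<close>, since k \<le> \<open>n k\<close>.\<close>
  have K0: "\<not> negligible (K 0)"
  proof
    assume neg: "negligible (K 0)"
    have "ball 0 (1/2) \<subseteq> K 0 \<union> (\<Union>j. S j)"
    proof
      fix z :: complex assume z: "z \<in> ball 0 (1/2)"
      show "z \<in> K 0 \<union> (\<Union>j. S j)"
      proof (rule ccontr)
        assume *: "z \<notin> K 0 \<union> (\<Union>j. S j)"
        have small: "cmod (Qcomp P 0 (n j) z) < 1 / 2" for j
        proof (induction j)
          case 0 then show ?case using z n by simp
        next
          case (Suc j)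
          then show ?case using good[of j z] * by (auto simp: good_step_def step)
        qed
        obtain k where "3 < cmod (Qcomp P 0 k z)" using * by (auto simp: K_def nonescaping_def not_le)
        then have "3 < cmod (Qcomp P 0 (n k) z)" using Qcomp_escape[where P = P, OF P, of 0 k "n k" z] ge[of k] by simp
        then show False using small[of k] by linarith
      qed
    qed
    then have "emeasure lebesgue (ball (0::complex) (1/2)) \<le> emeasure lebesgue (K 0 \<union> (\<Union>j. S j))"
      by (rule emeasure_mono) (use S(1) K_leb in \<open>auto intro!: sets.Un sets.countable_UN dest: fmeasurableD\<close>)
    also have "\<dots> \<le> emeasure lebesgue (K 0) + emeasure lebesgue (\<Union>j. S j)"
      by (rule emeasure_subadditive) (use S(1) K_leb in \<open>auto intro!: sets.countable_UN dest: fmeasurableD\<close>)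
    also have "emeasure lebesgue (K 0) = 0" using neg by (auto simp: negligible_iff_null_sets)
    also have "emeasure lebesgue (\<Union>j. S j) \<le> (\<Sum>j. emeasure lebesgue (S j))"
      by (rule emeasure_subadditive_countably) (use S(1) in \<open>auto dest: fmeasurableD\<close>)
    also have "\<dots> \<le> (\<Sum>j. ennreal (e j))"
    proof (intro suminf_le)
      show "emeasure lebesgue (S j) \<le> ennreal (e j)" for j
        unfolding emeasure_eq_measure2[OF S(1)] using S(2)[of j] by (intro ennreal_leI less_imp_le)
    qed auto
    also have "\<dots> = ennreal (c / 2)" using e e_sums by (intro suminf_ennreal_eq) (auto intro: less_imp_le)
    finally have "emeasure lebesgue (ball (0::complex) (1/2)) \<le> ennreal (c / 2)" by simp
    moreover have "emeasure lebesgue (ball (0::complex) (1/2)) = ennreal c"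
      unfolding c_def by (rule emeasure_eq_measure2) (rule lmeasurable_ball)
    ultimately show False using c by (simp add: ennreal_le_iff)
  qed
  have K_pos: "\<not> negligible (K m)" for m
  proof
    assume "negligible (K m)"
    from null_vimage[OF this, of 0 m] show False using K0 in_K[of 0 m] by simp
  qed

  \<comment> \<open>The radial field pulled back from block end \<open>n j\<close> to time m. If
    \<open>n j\<close> < m the composition is the identity by convention; since j \<le>
    \<open>n j\<close>, this affects finitely many j only.\<close>
  define T where "T = (\<lambda>m j. pullback (Qcomp P m (n j)) radial)"
  define reg where "reg = (\<lambda>m z. convergent (\<lambda>j. T m j z) \<and> cmod (lim (\<lambda>j. T m j z)) = 1)"
  have T_pull: "T m j z = T k j (Qcomp P m k z) * (cnj (deriv (Qcomp P m k) z) / deriv (Qcomp P m k) z)"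
    if "m \<le> k" "k \<le> n j" for m k j z
  proof -
    have "Qcomp P m (n j) = Qcomp P k (n j) \<circ> Qcomp P m k"
      using that by (auto simp: Qcomp_Qcomp[of m k "n j"])
    then have "T m j z = pullback (Qcomp P m k) (T k j) z"
      unfolding T_def using pullback_comp[OF fdiff fdiff] by simp
    then show ?thesis by (simp add: pullback_def)
  qed
  \<comment> \<open>From the index with k \<le> \<open>n j\<close> on, the two sequences differ by a
    factor that is independent of j and unimodular off critical points. The limits therefore satisfy
    the invariance relation exactly, although the radial field is only nearly invariant.\<close>
  have lim_pull: "(\<lambda>j. T m j z) \<longlonglongrightarrow> s * (cnj (deriv (Qcomp P m k) z) / deriv (Qcomp P m k) z)
      \<longleftrightarrow> (\<lambda>j. T k j (Qcomp P m k z)) \<longlonglongrightarrow> s"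
    if "m \<le> k" and d: "deriv (Qcomp P m k) z \<noteq> 0" for m k z s
  proof -
    let ?c = "cnj (deriv (Qcomp P m k) z) / deriv (Qcomp P m k) z"
    have "\<forall>\<^sub>F j in sequentially. k \<le> n j"
      using ge by (intro eventually_sequentiallyI[of k]) (auto intro: order_trans)
    then have "\<forall>\<^sub>F j in sequentially. T m j z = T k j (Qcomp P m k z) * ?c"
      by eventually_elim (use T_pull that in auto)
    then have "(\<lambda>j. T m j z) \<longlonglongrightarrow> s * ?c \<longleftrightarrow> (\<lambda>j. T k j (Qcomp P m k z) * ?c) \<longlonglongrightarrow> s * ?c"
      by (rule tendsto_cong)
    also have "\<dots> \<longleftrightarrow> (\<lambda>j. T k j (Qcomp P m k z)) \<longlonglongrightarrow> s"
      using d tendsto_mult_right_iff[of ?c] by simp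
    finally show ?thesis .
  qed
  have reg_iff: "reg m z \<longleftrightarrow> (\<exists>s. (\<lambda>j. T m j z) \<longlonglongrightarrow> s \<and> cmod s = 1)" for m z
    unfolding reg_def by (metis convergent_LIMSEQ_iff convergent_def limI)
  have reg_pull: "reg k (Qcomp P m k z) \<and>
      lim (\<lambda>j. T m j z) = lim (\<lambda>j. T k j (Qcomp P m k z)) * (cnj (deriv (Qcomp P m k) z) / deriv (Qcomp P m k) z)"
    if "m \<le> k" and d: "deriv (Qcomp P m k) z \<noteq> 0" and "reg m z" for m k z
  proof -
    let ?c = "cnj (deriv (Qcomp P m k) z) / deriv (Qcomp P m k) z"
    obtain s where s: "(\<lambda>j. T m j z) \<longlonglongrightarrow> s" "cmod s = 1" using \<open>reg m z\<close> reg_iff by blast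
    have c1: "cmod ?c = 1" "?c \<noteq> 0" using d by (simp_all add: norm_divide)
    have "s = s / ?c * ?c" using c1(2) by simp
    then have s': "(\<lambda>j. T k j (Qcomp P m k z)) \<longlonglongrightarrow> s / ?c" using s(1) lim_pull[OF that(1,2), of "s / ?c"] by metis
    moreover have "cmod (s / ?c) = 1" unfolding norm_divide[of s] using s(2) c1(1) by simp
    ultimately show ?thesis using limI[OF s(1)] limI[OF s'] \<open>s = s / ?c * ?c\<close> reg_iff by metis
  qed

  define N0 where "N0 = {z \<in> K 0. \<not> reg 0 z}"
  have N0: "negligible N0"
  proof -
    have "AE z in lebesgue. \<forall>\<^sub>F j in sequentially. z \<in> space lebesgue - S j"
    proof (rule borel_cantelli_AE1)
      show "S j \<in> sets lebesgue" "emeasure lebesgue (S j) < \<infinity>" for j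
        using S(1)[of j] by (auto simp: fmeasurable_def simp del: emeasure_completion)
      show "summable (\<lambda>j. measure lebesgue (S j))"
        using S(2) by (intro summable_comparison_test'[OF e_summable, of 0]) (auto intro: less_imp_le)
    qed
    then obtain A where A: "A \<in> null_sets lebesgue" "\<And>z. z \<notin> A \<Longrightarrow> \<forall>\<^sub>F j in sequentially. z \<notin> S j"
      by (auto simp: AE_iff_null_sets elim!: AE_E3)
    \<comment> \<open>Preimages of 0 and critical points are removed so that every term, and hence
      the limit, has modulus 1.\<close>
    define A' where "A' = A \<union> (\<Union>j. {z. Qcomp P 0 (n j) z \<in> {0}}) \<union> (\<Union>j. {z. deriv (Qcomp P 0 (n j)) z = 0})"
    have "negligible A'" unfolding A'_def
      by (intro negligible_Un negligible_Union_nat null_vimage null_crit negligible_sing)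
        (use A(1) in \<open>simp add: negligible_iff_null_sets\<close>)
    moreover have "N0 \<subseteq> A'"
    proof
      fix z assume z: "z \<in> N0"
      show "z \<in> A'"
      proof (rule ccontr)
        assume nA: "z \<notin> A'"
        then obtain j0 where j0: "\<And>j. j0 \<le> j \<Longrightarrow> z \<notin> S j"
          using A(2)[of z] by (auto simp: A'_def eventually_sequentially)
        have le3: "cmod (Qcomp P 0 k z) \<le> 3" for k using z by (auto simp: N0_def K_def nonescaping_def)
        have "cmod (T 0 (Suc j) z - T 0 j z) \<le> e j" if "j0 \<le> j" for j
        proof -
          \<comment> \<open>The orbit never exceeds modulus 3, which rules out the escaping
            alternative of \<open>good_step\<close>.\<close>
          have g: "cmod (pullback (fold poly (l j)) radial (Qcomp P 0 (n j) z) - radial (Qcomp P 0 (n j) z)) \<le> e j"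
            using good[OF le3 j0[OF that]] le3[of "n (Suc j)"] unfolding good_step_def step by linarith
          have "Qcomp P 0 (n (Suc j)) = fold poly (l j) \<circ> Qcomp P 0 (n j)" by (auto simp: step)
          then have "T 0 (Suc j) z = pullback (Qcomp P 0 (n j)) (pullback (fold poly (l j)) radial) z"
            unfolding T_def by (simp add: pullback_comp[OF fdiff field_differentiable_fold_poly])
          then show ?thesis unfolding T_def
            using norm_pullback_diff_le[of "Qcomp P 0 (n j)" "pullback (fold poly (l j)) radial" z radial] g by simp
        qed
        then have conv: "convergent (\<lambda>j. T 0 j z)" by (rule convergent_of_geometric_steps[OF _ e_summable])
        have "cmod (T 0 j z) = 1" for j unfolding T_def
          using nA by (intro norm_pullback_unimodular) (auto simp: A'_def radial_def norm_divide)
        then have "(\<lambda>j. 1) \<longlonglongrightarrow> cmod (lim (\<lambda>j. T 0 j z))"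
          using tendsto_norm[OF conv[unfolded convergent_LIMSEQ_iff]] by simp
        then have "cmod (lim (\<lambda>j. T 0 j z)) = 1" by (simp add: LIMSEQ_const_iff)
        then show False using conv z by (simp add: N0_def reg_def)
      qed
    qed
    ultimately show ?thesis by (rule negligible_subset)
  qed
  define N where "N = (\<lambda>m. {z \<in> K m. \<not> reg m z})"
  \<comment> \<open>Regularity holds almost everywhere on \<open>K 0\<close> and passes forward away
    from critical points. The irregular points at time m thus lie in the image of a null set under a
    holomorphic map.\<close>
  have N: "negligible (N m)" for m
  proof (rule negligible_subset)
    show "negligible (Qcomp P 0 m ` (N0 \<union> {z. deriv (Qcomp P 0 m) z = 0}))"
      by (intro negligible_differentiable_image_negligible negligible_Un N0 null_crit
          holomorphic_on_imp_differentiable_on holomorphic_Qcomp) simp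
    show "N m \<subseteq> Qcomp P 0 m ` (N0 \<union> {z. deriv (Qcomp P 0 m) z = 0})"
    proof
      fix z assume z: "z \<in> N m"
      obtain w where w: "z = Qcomp P 0 m w" using surjQ[of 0 m] by (metis surjD)
      have "w \<in> N0 \<union> {z. deriv (Qcomp P 0 m) z = 0}"
        using z in_K[of 0 m w] reg_pull[of 0 m w] by (auto simp: N_def N0_def w)
      then show "z \<in> Qcomp P 0 m ` (N0 \<union> {z. deriv (Qcomp P 0 m) z = 0})" using w by blast
    qed
  qed

  \<comment> \<open>The default 1, used only on a null set, makes the modulus 1 on all of
    \<open>K m\<close>. The support is then the whole Julia set and the countable exception is
    empty.\<close>
  define \<mu> where "\<mu> = (\<lambda>m z. if z \<in> K m then (if cmod (lim (\<lambda>j. T m j z)) = 1 then lim (\<lambda>j. T m j z) else 1) else 0)"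
  have inv: "AE z in lebesgue. pullback (Qcomp P m k) (\<mu> k) z = \<mu> m z" if "m < k" for m k
  proof (rule negligible_imp_AE)
    show "negligible (N m \<union> {z. deriv (Qcomp P m k) z = 0})" by (intro negligible_Un N null_crit)
    fix z assume z: "z \<notin> N m \<union> {z. deriv (Qcomp P m k) z = 0}"
    have mk: "m \<le> k" using that by simp
    show "pullback (Qcomp P m k) (\<mu> k) z = \<mu> m z"
    proof (cases "z \<in> K m")
      case True
      then have "reg m z" using z by (simp add: N_def)
      then show ?thesis using reg_pull[OF mk _ \<open>reg m z\<close>] z True in_K[OF mk, of z]
        by (auto simp: \<mu>_def reg_def pullback_def)
    next
      case False
      then show ?thesis using in_K[OF mk, of z] by (simp add: \<mu>_def pullback_def)
    qed
  qed
  have lf: "line_field_on (K m) (\<mu> m)" for m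
  proof -
    have [measurable]: "T m j \<in> borel_measurable borel" for j
      unfolding T_def by (intro borel_measurable_pullback_radial holomorphic_Qcomp)
    have [measurable]: "K m \<in> sets borel" by (rule K_borel)
    have "\<mu> m \<in> borel_measurable borel" unfolding \<mu>_def by measurable
    then have "\<mu> m \<in> borel_measurable lebesgue" by (simp add: measurable_completion)
    then show ?thesis using K_leb by (auto simp: line_field_on_def \<mu>_def)
  qed

  have deg: "degree (P m) = 2 \<and> cmod (coeff (P m) 2) = 1 \<and> (\<forall>k<2. cmod (coeff (P m) k) \<le> 1)" if "1 \<le> m" for m
  proof -
    have "P m \<in> quads" using P[of "m - 1"] that by simp
    then obtain a b where p: "P m = [:0, b, a:]" and a: "cmod a = 1" and b: "b \<in> {0, 1}"
      unfolding quads_def by blast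
    have "a \<noteq> 0" using a by auto
    then show ?thesis using a b by (auto simp: p numeral_2_eq_2 less_Suc_eq)
  qed
  \<comment> \<open>The leading coefficients have modulus 1 and their upper bound is strict, so the
    bound 2 is taken for them; the remaining coefficients are 0 or 1.\<close>
  have "bounded_seq_poly P 2 2 1" unfolding bounded_seq_poly_def using deg by auto
  moreover have "0 < emeasure lebesgue (K m)" for m
    using K_pos[of m] K_leb[of m] unfolding negligible_iff_null_sets null_sets_def by (auto simp: zero_less_iff_neq_zero)
  ultimately show ?thesis
    by (intro exI[of _ P] exI[of _ 2] exI[of _ "2::real"] exI[of _ "1::real"] exI[of _ \<mu>] conjI)
      (use deg K_leb inv lf in \<open>auto simp: julia_C julia intro!: exI[of _ "K _"]\<close>)
qed

end
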